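(* Let $\mathbb{K}$ be a field. Every pre-commutative skew PBW extension $A=\sigma(\mathbb{K})\langle x_1,\dots,x_n\rangle$ of $\mathbb{K}$ which is a $\mathbb{K}$-algebra is Koszul.
   Context: Skew PBW extension. Let $\mathbb{K}$ be a field. A ring $A\supseteq\mathbb{K}$ is a skew PBW extension of $\mathbb{K}$ in the variables $x_1,\dots,x_n\in A$, written $A=\sigma(\mathbb{K})\langle x_1,\dots,x_n\rangle$, if: $A$ is a free left $\mathbb{K}$-module with basis the standard monomials $\{x_1^{\alpha_1}\cdots x_n^{\alpha_n}\mid \alpha\in\mathbb{N}^n\}$; for each $i$ and each $r\in\mathbb{K}\setminus\{0\}$ there is $c_{i,r}\in\mathbb{K}\setminus\{0\}$ with $x_ir-c_{i,r}x_i\in\mathbb{K}$; and for all $1\le i,j\le n$ there is $c_{i,j}\in\mathbb{K}\setminus\{0\}$ with $x_jx_i-c_{i,j}x_ix_j\in\mathbb{K}+\mathbb{K}x_1+\cdots+\mathbb{K}x_n$. That $A$ is a $\mathbb{K}$-algebra means that $\mathbb{K}$ is central in $A$, i.e. $x_ir=rx_i$ (such an extension is called constant). $A$ is pre-commutative if for all $1\le i,j\le n$ there is $c_{i,j}\in\mathbb{K}\setminus\{0\}$ with $x_jx_i-c_{i,j}x_ix_j\in\mathbb{K}x_1+\cdots+\mathbb{K}x_n$. Pre-Koszul. Let $L=\mathbb{K}\langle x_1,\dots,x_n\rangle$ be the free associative algebra. An algebra $B=L/I$ is pre-Koszul if the two-sided ideal $I$ is generated by elements of the form $\sum_{i}c_ix_i+\sum_{j,k}c_{j,k}x_jx_k$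 with $c_i,c_{j,k}\in\mathbb{K}$, and homogeneous pre-Koszul if moreover all $c_i=0$. The associated homogeneous pre-Koszul algebra $B^{(0)}$ of a pre-Koszul algebra $B$ is the algebra obtained by truncating the defining relations, leaving only their homogeneous quadratic parts $\sum_{j,k}c_{j,k}x_jx_k$. For a pre-commutative skew PBW extension $A=\sigma(\mathbb{K})\langle x_1,\dots,x_n\rangle$ of $\mathbb{K}$ which is a $\mathbb{K}$-algebra, $I$ is the kernel of $L\to A$, $x_i\mapsto x_i$, and the defining relations are the relations $x_jx_i-c_{i,j}x_ix_j+r_1x_1+\cdots+r_nx_n$ ($1\le i,j\le n$, with $r_1,\dots,r_n\in\mathbb{K}$ depending on $i,j$) that hold in $A$ by pre-commutativity. Koszul. A homogeneous pre-Koszul algebra $B$ is graded with $\deg x_i=1$, and $\mathbb{K}=B/B_{\ge1}$ is a graded $B$-module concentrated in degree $0$. $B$ is homogeneous Koszul if the following equivalent conditions hold: (i) $\mathrm{Ext}^{i,j}_B(\mathbb{K},\mathbb{K}):=\mathrm{Ext}^i_B(\mathbb{K},\mathbb{K}(-j))=0$ for all $i\ne j$, where Ext is computed in the category of graded $B$-modules with degree-preserving maps and $M(-j)_l=M_{l-j}$; (ii) the Yoneda algebra $\bigoplus_{i,j}\mathrm{Ext}^{i,j}_B(\mathbb{K},\mathbb{K})$ is generated by $\mathrm{Ext}^{1,1}_B(\mathbb{K},\mathbb{K})$; (iii) $\mathbb{K}$ admits a resolution $\cdots\to P_2\to P_1\to P_0\to\mathbb{K}\to0$ by graded free $B$-modules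 with $P_i$ generated in degree $i$. A pre-Koszul algebra $B$ is Koszul if $B^{(0)}$ is homogeneous Koszul. *)

theory Defs
  imports Complex_Main "HOL-Library.Poly_Mapping" "HOL-Algebra.QuotRing" "HOL-Algebra.Module"
begin

section \<open>The free associative algebra\<close>

text \<open>
  Words are wrapped in a datatype so that concatenation can serve as the (noncommutative) addition
  of class \<^class>\<open>monoid_add\<close>. The product of \<^typ>\<open>'m::monoid_add \<Rightarrow>\<^sub>0 'k\<close> in the library is convolution,
  so finitely supported functions on words form the free algebra.
\<close>

datatype 'v free_monoid = Word (letters: "'v list")

instantiation free_monoid :: (type) monoid_add
begin

definition zero_free_monoid :: "'a free_monoid" where
  "zero_free_monoid = Word []"

definition plus_free_monoid :: "'a free_monoid \<Rightarrow> 'a free_monoid \<Rightarrow> 'a free_monoid" where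
  "plus_free_monoid u v = Word (letters u @ letters v)"

instance
  by standard (simp_all add: zero_free_monoid_def plus_free_monoid_def)

end

type_synonym 'k free_alg = "nat free_monoid \<Rightarrow>\<^sub>0 'k"

abbreviation term_of_word :: "nat list \<Rightarrow> 'k::zero \<Rightarrow> 'k free_alg" where
  "term_of_word w c \<equiv> Poly_Mapping.single (Word w) c"

text \<open>The variables of \<open>free_algebra n\<close> are \<open>term_of_word [i] 1\<close> for \<open>i \<in> {1..n}\<close>.\<close>

definition free_algebra :: "nat \<Rightarrow> ('k::field free_alg) ring" where
  "free_algebra n =
    \<lparr>carrier = {f. \<forall>w\<in>Poly_Mapping.keys f. set (letters w) \<subseteq> {1..n}},
     mult = (*), one = 1, zero = 0, add = (+)\<rparr>"

definition free_algebra_degree :: "nat \<Rightarrow> int \<Rightarrow> ('k::field free_alg) set" where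
  "free_algebra_degree n d =
    {f \<in> carrier (free_algebra n). \<forall>w\<in>Poly_Mapping.keys f. int (length (letters w)) = d}"

definition linear_quadratic :: "nat \<Rightarrow> ('k::field free_alg) set" where
  "linear_quadratic n =
    {(\<Sum>i\<in>{1..n}. term_of_word [i] (c i)) + (\<Sum>j\<in>{1..n}. \<Sum>k\<in>{1..n}. term_of_word [j, k] (q j k))
      | c q. True}"

definition homogeneous_quadratic :: "nat \<Rightarrow> ('k::field free_alg) set" where
  "homogeneous_quadratic n =
    {(\<Sum>j\<in>{1..n}. \<Sum>k\<in>{1..n}. term_of_word [j, k] (q j k)) | q. True}"

definition quadratic_part :: "'k::field free_alg \<Rightarrow> 'k free_alg" where
  "quadratic_part f =
    (\<Sum>w\<in>{w \<in> Poly_Mapping.keys f. length (letters w) = 2}.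
       Poly_Mapping.single w (Poly_Mapping.lookup f w))"

section \<open>Graded left modules\<close>

text \<open>
  The locale \<^locale>\<open>module\<close> of the library requires a commutative ring of scalars; this is the same
  list of axioms over an arbitrary ring. Of the record type \<^typ>\<open>('b, 'm) module\<close>, only the
  additive structure and the scalar multiplication are used.
\<close>

locale left_module = R?: ring R + M?: abelian_group M
  for R (structure) and M (structure) +
  assumes smult_closed:
      "\<lbrakk>a \<in> carrier R; x \<in> carrier M\<rbrakk> \<Longrightarrow> a \<odot>\<^bsub>M\<^esub> x \<in> carrier M"
    and smult_l_distr:
      "\<lbrakk>a \<in> carrier R; b \<in> carrier R; x \<in> carrier M\<rbrakk> \<Longrightarrow>
        (a \<oplus> b) \<odot>\<^bsub>M\<^esub> x = a \<odot>\<^bsub>M\<^esub> x \<oplus>\<^bsub>M\<^esub> b \<odot>\<^bsub>M\<^esub> x"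
    and smult_r_distr:
      "\<lbrakk>a \<in> carrier R; x \<in> carrier M; y \<in> carrier M\<rbrakk> \<Longrightarrow>
        a \<odot>\<^bsub>M\<^esub> (x \<oplus>\<^bsub>M\<^esub> y) = a \<odot>\<^bsub>M\<^esub> x \<oplus>\<^bsub>M\<^esub> a \<odot>\<^bsub>M\<^esub> y"
    and smult_assoc:
      "\<lbrakk>a \<in> carrier R; b \<in> carrier R; x \<in> carrier M\<rbrakk> \<Longrightarrow>
        (a \<otimes> b) \<odot>\<^bsub>M\<^esub> x = a \<odot>\<^bsub>M\<^esub> (b \<odot>\<^bsub>M\<^esub> x)"
    and smult_one:
      "x \<in> carrier M \<Longrightarrow> \<one> \<odot>\<^bsub>M\<^esub> x = x"

definition direct_sum_grading :: "('b, 'm) module \<Rightarrow> (int \<Rightarrow> 'm set) \<Rightarrow> bool" where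
  "direct_sum_grading M G \<longleftrightarrow>
    (\<forall>d. additive_subgroup (G d) M) \<and>
    (\<forall>m\<in>carrier M. \<exists>!f. (\<forall>d. f d \<in> G d) \<and> finite {d. f d \<noteq> \<zero>\<^bsub>M\<^esub>} \<and>
       m = (\<Oplus>\<^bsub>M\<^esub>d\<in>{d. f d \<noteq> \<zero>\<^bsub>M\<^esub>}. f d))"

definition graded_module ::
  "'b ring \<Rightarrow> (int \<Rightarrow> 'b set) \<Rightarrow> ('b, 'm) module \<Rightarrow> (int \<Rightarrow> 'm set) \<Rightarrow> bool" where
  "graded_module B GB M G \<longleftrightarrow>
    left_module B M \<and> direct_sum_grading M G \<and>
    (\<forall>d e. \<forall>b\<in>GB d. \<forall>m\<in>G e. b \<odot>\<^bsub>M\<^esub> m \<in> G (d + e))"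

definition graded_hom ::
  "'b ring \<Rightarrow> ('b, 'm) module \<Rightarrow> (int \<Rightarrow> 'm set) \<Rightarrow> ('b, 'p) module \<Rightarrow> (int \<Rightarrow> 'p set) \<Rightarrow>
    ('m \<Rightarrow> 'p) \<Rightarrow> bool" where
  "graded_hom B M G N H \<phi> \<longleftrightarrow>
    \<phi> \<in> carrier M \<rightarrow> carrier N \<and>
    (\<forall>x\<in>carrier M. \<forall>y\<in>carrier M. \<phi> (x \<oplus>\<^bsub>M\<^esub> y) = \<phi> x \<oplus>\<^bsub>N\<^esub> \<phi> y) \<and>
    (\<forall>b\<in>carrier B. \<forall>x\<in>carrier M. \<phi> (b \<odot>\<^bsub>M\<^esub> x) = b \<odot>\<^bsub>N\<^esub> \<phi> x) \<and>
    (\<forall>d. \<phi> ` G d \<subseteq> H d)"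

definition module_basis :: "'b ring \<Rightarrow> ('b, 'm) module \<Rightarrow> 'm set \<Rightarrow> bool" where
  "module_basis B M E \<longleftrightarrow>
    E \<subseteq> carrier M \<and>
    (\<forall>m\<in>carrier M. \<exists>!c. (\<forall>e. c e \<in> carrier B) \<and> (\<forall>e. e \<notin> E \<longrightarrow> c e = \<zero>\<^bsub>B\<^esub>) \<and>
       finite {e. c e \<noteq> \<zero>\<^bsub>B\<^esub>} \<and> m = (\<Oplus>\<^bsub>M\<^esub>e\<in>{e. c e \<noteq> \<zero>\<^bsub>B\<^esub>}. c e \<odot>\<^bsub>M\<^esub> e))"

definition graded_free_in_degree ::
  "'b ring \<Rightarrow> (int \<Rightarrow> 'b set) \<Rightarrow> ('b, 'm) module \<Rightarrow> (int \<Rightarrow> 'm set) \<Rightarrow> int \<Rightarrow> bool" where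
  "graded_free_in_degree B GB M G d \<longleftrightarrow>
    graded_module B GB M G \<and> (\<exists>E \<subseteq> G d. module_basis B M E)"

section \<open>Koszul algebras\<close>

definition positive_part :: "'b ring \<Rightarrow> (int \<Rightarrow> 'b set) \<Rightarrow> 'b set" where
  "positive_part B GB =
    {(\<Oplus>\<^bsub>B\<^esub>d\<in>D. b d) | D b. finite D \<and> D \<subseteq> {1..} \<and> (\<forall>d\<in>D. b d \<in> GB d)}"

definition residue_module :: "'b ring \<Rightarrow> (int \<Rightarrow> 'b set) \<Rightarrow> ('b, 'b set) module" where
  "residue_module B GB =
    (let Q = B Quot positive_part B GB in
      \<lparr>carrier = carrier Q, mult = mult Q, one = one Q, zero = zero Q, add = add Q,
       smult = (\<lambda>b z. (positive_part B GB +>\<^bsub>B\<^esub> b) \<otimes>\<^bsub>Q\<^esub> z)\<rparr>)"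

definition residue_grading :: "'b ring \<Rightarrow> (int \<Rightarrow> 'b set) \<Rightarrow> int \<Rightarrow> 'b set set" where
  "residue_grading B GB d =
    (if d = 0 then carrier (residue_module B GB) else {\<zero>\<^bsub>residue_module B GB\<^esub>})"

text \<open>
  The residue module has a graded free resolution whose \<open>i\<close>-th term has a basis in degree \<open>i\<close>.
  The elements of the terms are taken from \<^typ>\<open>nat \<Rightarrow> 'b\<close> because HOL cannot quantify over types.
  This type contains copies of all free modules of countable rank. For a finitely generated
  algebra over a field, generated in degree one, it is no restriction: a resolution of this shape
  is minimal, so its \<open>i\<close>-th rank is at most \<open>n ^ i\<close> for \<open>n\<close> generators.
\<close>

definition has_linear_free_resolution :: "'b ring \<Rightarrow> (int \<Rightarrow> 'b set) \<Rightarrow> bool" where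
  "has_linear_free_resolution B GB \<longleftrightarrow>
    (\<exists>(P :: nat \<Rightarrow> ('b, nat \<Rightarrow> 'b) module) G \<delta> \<epsilon>.
      (\<forall>i. graded_free_in_degree B GB (P i) (G i) (int i)) \<and>
      (\<forall>i. graded_hom B (P (Suc i)) (G (Suc i)) (P i) (G i) (\<delta> i)) \<and>
      graded_hom B (P 0) (G 0) (residue_module B GB) (residue_grading B GB) \<epsilon> \<and>
      \<epsilon> ` carrier (P 0) = carrier (residue_module B GB) \<and>
      {p \<in> carrier (P 0). \<epsilon> p = \<zero>\<^bsub>residue_module B GB\<^esub>} = \<delta> 0 ` carrier (P 1) \<and>
      (\<forall>i. {p \<in> carrier (P (Suc i)). \<delta> i p = \<zero>\<^bsub>P i\<^esub>} = \<delta> (Suc i) ` carrier (P (Suc (Suc i)))))"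

definition presented_algebra :: "nat \<Rightarrow> ('k::field free_alg) set \<Rightarrow> ('k free_alg set) ring" where
  "presented_algebra n S = free_algebra n Quot (Idl\<^bsub>free_algebra n\<^esub> S)"

definition presented_algebra_degree ::
  "nat \<Rightarrow> ('k::field free_alg) set \<Rightarrow> int \<Rightarrow> ('k free_alg set) set" where
  "presented_algebra_degree n S d =
    (\<lambda>f. (Idl\<^bsub>free_algebra n\<^esub> S) +>\<^bsub>free_algebra n\<^esub> f) ` free_algebra_degree n d"

definition homogeneous_koszul :: "nat \<Rightarrow> ('k::field free_alg) set \<Rightarrow> bool" where
  "homogeneous_koszul n S \<longleftrightarrow>
    S \<subseteq> homogeneous_quadratic n \<and>
    has_linear_free_resolution (presented_algebra n S) (presented_algebra_degree n S)"

text \<open>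
  An algebra over \<open>'k\<close> is a ring \<open>'a\<close> with a map \<open>\<iota> :: 'k \<Rightarrow> 'a\<close>. The predicates \<open>pre_koszul\<close> and
  \<open>koszul\<close> refer to a set \<open>R\<close> of defining relations, because the associated homogeneous algebra
  is obtained by truncating these.
\<close>

definition eval_free :: "('k::field \<Rightarrow> 'a::ring_1) \<Rightarrow> (nat \<Rightarrow> 'a) \<Rightarrow> 'k free_alg \<Rightarrow> 'a" where
  "eval_free \<iota> x f =
    (\<Sum>w\<in>Poly_Mapping.keys f. \<iota> (Poly_Mapping.lookup f w) * prod_list (map x (letters w)))"

definition pre_koszul ::
  "('k::field \<Rightarrow> 'a::ring_1) \<Rightarrow> (nat \<Rightarrow> 'a) \<Rightarrow> nat \<Rightarrow> 'k free_alg set \<Rightarrow> bool" where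
  "pre_koszul \<iota> x n R \<longleftrightarrow>
    eval_free \<iota> x ` carrier (free_algebra n) = UNIV \<and>
    R \<subseteq> linear_quadratic n \<and>
    {f \<in> carrier (free_algebra n). eval_free \<iota> x f = 0} = Idl\<^bsub>free_algebra n\<^esub> R"

definition koszul ::
  "('k::field \<Rightarrow> 'a::ring_1) \<Rightarrow> (nat \<Rightarrow> 'a) \<Rightarrow> nat \<Rightarrow> 'k free_alg set \<Rightarrow> bool" where
  "koszul \<iota> x n R \<longleftrightarrow> pre_koszul \<iota> x n R \<and> homogeneous_koszul n (quadratic_part ` R)"

section \<open>Skew PBW extensions of a field\<close>

definition field_embedding :: "('k::field \<Rightarrow> 'a::ring_1) \<Rightarrow> bool" where
  "field_embedding \<iota> \<longleftrightarrow>
    \<iota> 1 = 1 \<and> (\<forall>r s. \<iota> (r + s) = \<iota> r + \<iota> s) \<and> (\<forall>r s. \<iota> (r * s) = \<iota> r * \<iota> s) \<and> inj \<iota>"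

definition exponents :: "nat \<Rightarrow> (nat \<Rightarrow> nat) set" where
  "exponents n = {\<alpha>. \<forall>i. i \<notin> {1..n} \<longrightarrow> \<alpha> i = 0}"

definition standard_monomial :: "(nat \<Rightarrow> 'a::ring_1) \<Rightarrow> nat \<Rightarrow> (nat \<Rightarrow> nat) \<Rightarrow> 'a" where
  "standard_monomial x n \<alpha> = prod_list (map (\<lambda>i. x i ^ \<alpha> i) [1..<Suc n])"

text \<open>
  The standard monomials form a basis as a family: distinct exponents give distinct monomials.
\<close>

definition skew_PBW_extension ::
  "('k::field \<Rightarrow> 'a::ring_1) \<Rightarrow> (nat \<Rightarrow> 'a) \<Rightarrow> nat \<Rightarrow> bool" where
  "skew_PBW_extension \<iota> x n \<longleftrightarrow>
    field_embedding \<iota> \<and>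
    inj_on (standard_monomial x n) (exponents n) \<and>
    \<not> Modules.module.dependent (\<lambda>r a. \<iota> r * a) (standard_monomial x n ` exponents n) \<and>
    Modules.module.span (\<lambda>r a. \<iota> r * a) (standard_monomial x n ` exponents n) = UNIV \<and>
    (\<forall>i\<in>{1..n}. \<forall>r. r \<noteq> 0 \<longrightarrow> (\<exists>c. c \<noteq> 0 \<and> x i * \<iota> r - \<iota> c * x i \<in> range \<iota>)) \<and>
    (\<forall>i\<in>{1..n}. \<forall>j\<in>{1..n}. \<exists>c. c \<noteq> 0 \<and>
       x j * x i - \<iota> c * x i * x j \<in> {\<iota> s + (\<Sum>k\<in>{1..n}. \<iota> (r k) * x k) | s r. True})"

definition constant_extension :: "('k::field \<Rightarrow> 'a::ring_1) \<Rightarrow> bool" where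
  "constant_extension \<iota> \<longleftrightarrow> (\<forall>r a. \<iota> r * a = a * \<iota> r)"

definition pre_commutative ::
  "('k::field \<Rightarrow> 'a::ring_1) \<Rightarrow> (nat \<Rightarrow> 'a) \<Rightarrow> nat \<Rightarrow> bool" where
  "pre_commutative \<iota> x n \<longleftrightarrow>
    (\<forall>i\<in>{1..n}. \<forall>j\<in>{1..n}. \<exists>c. c \<noteq> 0 \<and>
       x j * x i - \<iota> c * x i * x j \<in> {(\<Sum>k\<in>{1..n}. \<iota> (r k) * x k) | r. True})"

definition defining_relations ::
  "('k::field \<Rightarrow> 'a::ring_1) \<Rightarrow> (nat \<Rightarrow> 'a) \<Rightarrow> nat \<Rightarrow> 'k free_alg set" where
  "defining_relations \<iota> x n =
    {f. eval_free \<iota> x f = 0 \<and>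
      (\<exists>i\<in>{1..n}. \<exists>j\<in>{1..n}. \<exists>c r. c \<noteq> 0 \<and>
         f = term_of_word [j, i] 1 - term_of_word [i, j] c + (\<Sum>k\<in>{1..n}. term_of_word [k] (r k)))}"

end

theory Submission
  imports Defs "HOL-Library.Multiset" "HOL-Library.Nat_Bijection"
begin

text \<open>
  Truncating the relations leaves the relations \<open>x\<^sub>a x\<^sub>b = q a b x\<^sub>b x\<^sub>a\<close> of quantum affine space: linear
  independence of the standard monomials forces the coefficients of the redundant relations
  (\<open>i = j\<close>, or \<open>i\<close> and \<open>j\<close> exchanged) to agree with these. Sorting words, with a scalar factor
  for every exchange of letters, is a projection of the free algebra onto the span of the sorted words
  whose kernel is the ideal of the truncated relations, so computations in the quotient
  become computations with sorted words. The quantum Koszul complex \<open>B \<otimes> \<Lambda>\<^sup>i\<close> is exact because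
  moving the largest letter of a sorted word into the exterior factor is a contracting homotopy.

  Every ideal containing suitable relations \<open>x\<^sub>a x\<^sub>b - q a b x\<^sub>b x\<^sub>a + \<Sum>\<^sub>k r\<^sub>k x\<^sub>k\<close> rewrites words into sorted
  words. Together with linear independence of the standard monomials, this identifies the
  kernel of the free algebra's evaluation map with the ideal of the defining relations.
\<close>

section \<open>Word polynomials\<close>

text \<open>Sorting behaves well for every choice of \<open>q\<close>, without consistency
  conditions: the factor for moving one word past another depends only on their multisets of
  letters, so sorting a factor of a product beforehand changes nothing. For the extension itself the
  linear terms destroy this, and overlaps of the rewriting rules would have to be resolved; the PBW
  hypothesis replaces that check, since a sorted polynomial with value 0 must vanish. The homotopy
  is linear over the field only. The complex is therefore studied through functions on subsets with
  values in the free algebra, all homological degrees at once, and identities are proved after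
  sorting; cosets and graded modules come in only when the result is transported. Modules are left
  modules, so the differential multiplies by variables on the right and the homotopy removes the
  last letter. The factors \<open>- q u s\<close> are those of a quantum exterior algebra; for
  \<open>q = 1\<close> they give the usual Koszul sign, counting the elements above
  \<open>s\<close>.\<close>

lemma Word_plus [simp]: "Word u + Word v = Word (u @ v)"
  by (simp add: plus_free_monoid_def)

lemma zero_eq_Word: "(0 :: 'v free_monoid) = Word []"
  by (simp add: zero_free_monoid_def)

abbreviation coeff :: "'k::zero free_alg \<Rightarrow> nat list \<Rightarrow> 'k" where
  "coeff f w \<equiv> Poly_Mapping.lookup f (Word w)"

abbreviation const :: "'k::zero \<Rightarrow> 'k free_alg" where
  "const c \<equiv> Poly_Mapping.single 0 c"

text \<open>One predicate on words covers the carrier of the free algebra, its homogeneous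
  components and the span of the sorted words, so closure properties are proved only once.\<close>

definition wpolys :: "(nat list \<Rightarrow> bool) \<Rightarrow> 'k::zero free_alg set" where
  "wpolys P = {f. \<forall>w\<in>Poly_Mapping.keys f. P (letters w)}"

lemma wpolys_iff: "f \<in> wpolys P \<longleftrightarrow> (\<forall>w. coeff f w \<noteq> 0 \<longrightarrow> P w)"
proof (intro iffI allI impI)
  fix w
  assume "f \<in> wpolys P" "coeff f w \<noteq> 0"
  then show "P w"
    by (force simp: wpolys_def in_keys_iff)
next
  assume *: "\<forall>w. coeff f w \<noteq> 0 \<longrightarrow> P w"
  show "f \<in> wpolys P"
    unfolding wpolys_def
  proof safe
    fix w
    assume "w \<in> Poly_Mapping.keys f"
    then show "P (letters w)"
      using * by (cases w) (auto simp: in_keys_iff)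
  qed
qed

lemma wpolys_mono: "f \<in> wpolys P \<Longrightarrow> (\<And>w. P w \<Longrightarrow> Q w) \<Longrightarrow> f \<in> wpolys Q"
  by (auto simp: wpolys_def)

lemma wpolys_zero [simp]: "0 \<in> wpolys P"
  by (simp add: wpolys_def)

lemma wpolys_add: "f \<in> wpolys P \<Longrightarrow> g \<in> wpolys P \<Longrightarrow> f + g \<in> wpolys P"
  for f :: "'k::monoid_add free_alg"
  unfolding wpolys_iff lookup_add by (metis add.right_neutral)

lemma wpolys_uminus: "f \<in> wpolys P \<Longrightarrow> - f \<in> wpolys P"
  for f :: "'k::ab_group_add free_alg"
  by (simp add: wpolys_iff)

lemma wpolys_diff: "f \<in> wpolys P \<Longrightarrow> g \<in> wpolys P \<Longrightarrow> f - g \<in> wpolys P"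
  for f :: "'k::ab_group_add free_alg"
  using wpolys_add[of f P "- g"] by (simp add: wpolys_uminus)

lemma wpolys_sum: "(\<And>a. a \<in> A \<Longrightarrow> f a \<in> wpolys P) \<Longrightarrow> sum f A \<in> wpolys P"
  for f :: "'b \<Rightarrow> 'k::comm_monoid_add free_alg"
  by (induction A rule: infinite_finite_induct) (auto intro: wpolys_add)

lemma wpolys_term: "P w \<Longrightarrow> term_of_word w c \<in> wpolys P"
  by (simp add: wpolys_def)

lemma wpolys_one: "P [] \<Longrightarrow> (1 :: 'k::zero_neq_one free_alg) \<in> wpolys P"
  by (simp add: wpolys_def zero_eq_Word)

lemma wpolys_mult:
  fixes f g :: "'k::semiring_0 free_alg"
  assumes "f \<in> wpolys P" "g \<in> wpolys Q" "\<And>u v. P u \<Longrightarrow> Q v \<Longrightarrow> T (u @ v)"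
  shows "f * g \<in> wpolys T"
  using assms keys_mult[of f g] by (fastforce simp: wpolys_def plus_free_monoid_def)

lemma wpolys_letters_mult:
  fixes f g :: "'k::semiring_0 free_alg"
  assumes "f \<in> wpolys (\<lambda>w. set w \<subseteq> A)" "g \<in> wpolys (\<lambda>w. set w \<subseteq> A)"
  shows "f * g \<in> wpolys (\<lambda>w. set w \<subseteq> A)"
  using assms by (rule wpolys_mult) auto

lemma sum_of_terms: "f = (\<Sum>w\<in>Poly_Mapping.keys f. term_of_word (letters w) (Poly_Mapping.lookup f w))"
proof (rule poly_mapping_eqI)
  fix v
  have "Poly_Mapping.lookup (\<Sum>w\<in>Poly_Mapping.keys f. term_of_word (letters w) (Poly_Mapping.lookup f w)) v
      = (\<Sum>w\<in>Poly_Mapping.keys f. if w = v then Poly_Mapping.lookup f w else 0)"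
    unfolding lookup_sum by (rule sum.cong) (auto simp: lookup_single when_def)
  then show "Poly_Mapping.lookup f v =
      Poly_Mapping.lookup (\<Sum>w\<in>Poly_Mapping.keys f. term_of_word (letters w) (Poly_Mapping.lookup f w)) v"
    by (simp add: in_keys_iff)
qed

text \<open>The word case carries an arbitrary coefficient, so additivity suffices and no case for
  scalar multiples arises.\<close>

lemma wpolys_induct [consumes 1, case_names zero add word]:
  fixes f :: "'k::comm_monoid_add free_alg"
  assumes f: "f \<in> wpolys P" and "Q 0" and "\<And>f g. Q f \<Longrightarrow> Q g \<Longrightarrow> Q (f + g)"
    and t: "\<And>w c. P w \<Longrightarrow> Q (term_of_word w c)"
  shows "Q f"
proof -
  have "Q (sum (\<lambda>w. term_of_word (letters w) (Poly_Mapping.lookup f w)) A)"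
    if "A \<subseteq> Poly_Mapping.keys f" for A
    using finite_subset[OF that finite_keys] that
  proof (induction A rule: finite_induct)
    case (insert w A)
    then have "P (letters w)"
      using f by (auto simp: wpolys_def)
    then have "Q (term_of_word (letters w) (Poly_Mapping.lookup f w))"
      by (rule t)
    with insert assms(3) show ?case
      by simp
  qed (simp add: assms)
  then show ?thesis
    using sum_of_terms[of f] by (metis order_refl)
qed

text \<open>The standard argument for identities between maps on the free algebra: both sides are
  additive, so it is enough to compare them on single terms. Where \<open>goal_cases\<close> is used
  with it, the fifth goal is this comparison.\<close>

lemma additive_eqI:
  fixes f :: "'k::comm_monoid_add free_alg" and F G :: "'k free_alg \<Rightarrow> 'b::monoid_add"
  assumes "f \<in> wpolys P" "F 0 = 0" "G 0 = 0"
    and "\<And>f g. F (f + g) = F f + F g" "\<And>f g. G (f + g) = G f + G g"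
    and "\<And>w c. P w \<Longrightarrow> F (term_of_word w c) = G (term_of_word w c)"
  shows "F f = G f"
  using assms(1) by (induction rule: wpolys_induct) (simp_all add: assms(2-))

lemma wpolys_True: "f \<in> wpolys (\<lambda>_. True)"
  by (simp add: wpolys_def)

definition word_lin :: "(nat list \<Rightarrow> 'k::zero \<Rightarrow> 'b::comm_monoid_add) \<Rightarrow> 'k free_alg \<Rightarrow> 'b" where
  "word_lin g f = (\<Sum>w\<in>Poly_Mapping.keys f. g (letters w) (Poly_Mapping.lookup f w))"

lemma word_lin_zero [simp]: "word_lin g 0 = 0"
  by (simp add: word_lin_def)

lemma word_lin_term [simp]: "g w 0 = 0 \<Longrightarrow> word_lin g (term_of_word w c) = g w c"
  by (simp add: word_lin_def)

lemma word_lin_add: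
  fixes f h :: "'k::comm_monoid_add free_alg"
  assumes "\<And>w. g w 0 = 0" "\<And>w a b. g w (a + b) = g w a + g w b"
  shows "word_lin g (f + h) = word_lin g f + word_lin g h"
proof -
  \<comment> \<open>Cancellation can make the support of \<open>f + h\<close> smaller than this
    union, so all three sums are extended to the union.\<close>
  let ?K = "Poly_Mapping.keys f \<union> Poly_Mapping.keys h"
  have "word_lin g p = (\<Sum>w\<in>?K. g (letters w) (Poly_Mapping.lookup p w))"
    if "Poly_Mapping.keys p \<subseteq> ?K" for p
    unfolding word_lin_def
    using that by (intro sum.mono_neutral_left) (auto simp: assms in_keys_iff)
  from this[of f] this[of h] this[of "f + h"] show ?thesis
    using keys_add[of f h] by (simp add: lookup_add assms sum.distrib)
qed

section \<open>Sorting words in quantum affine space\<close>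

text \<open>In quantum affine space \<open>x\<^sub>a x\<^sub>b = q a b x\<^sub>b x\<^sub>a\<close> for \<open>b < a\<close>; only these values of \<open>q\<close> are used.
  The weight of a word is the factor by which the word differs from its sorted rearrangement.\<close>

definition swap_weight :: "(nat \<Rightarrow> nat \<Rightarrow> 'k::comm_ring_1) \<Rightarrow> nat \<Rightarrow> nat \<Rightarrow> 'k" where
  "swap_weight q a b = (if b < a then q a b else 1)"

definition cross_weight :: "(nat \<Rightarrow> nat \<Rightarrow> 'k::comm_ring_1) \<Rightarrow> nat list \<Rightarrow> nat list \<Rightarrow> 'k" where
  "cross_weight q u v = (\<Prod>a\<leftarrow>u. \<Prod>b\<leftarrow>v. swap_weight q a b)"

fun sort_weight :: "(nat \<Rightarrow> nat \<Rightarrow> 'k::comm_ring_1) \<Rightarrow> nat list \<Rightarrow> 'k" where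
  "sort_weight q [] = 1"
| "sort_weight q (a # w) = (\<Prod>b\<leftarrow>w. swap_weight q a b) * sort_weight q w"

text \<open>Inversions of \<open>u @ v\<close> lie inside \<open>u\<close>, inside \<open>v\<close>
  or across. The factor for the last kind ignores the order within \<open>u\<close> and within
  \<open>v\<close>, which makes sorting compatible with multiplication.\<close>

lemma sort_weight_append:
  "sort_weight q (u @ v) = sort_weight q u * sort_weight q v * cross_weight q u v"
  by (induction u) (simp_all add: cross_weight_def mult_ac)

lemma prod_list_mset_cong: "mset u = mset v \<Longrightarrow> prod_list (map f u) = prod_list (map f v)"
  for f :: "'b \<Rightarrow> 'k::comm_monoid_mult"
  by (metis mset_map prod_mset_prod_list)

lemma cross_weight_cong: "mset u = mset u' \<Longrightarrow> mset v = mset v' \<Longrightarrow> cross_weight q u v = cross_weight q u' v'"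
proof -
  assume u: "mset u = mset u'" and v: "mset v = mset v'"
  have "cross_weight q u v = cross_weight q u v'"
    unfolding cross_weight_def by (simp add: prod_list_mset_cong[OF v])
  also have "\<dots> = cross_weight q u' v'"
    unfolding cross_weight_def by (rule prod_list_mset_cong[OF u])
  finally show ?thesis .
qed

lemma sort_weight_sorted: "sorted w \<Longrightarrow> sort_weight q w = 1"
proof (induction w)
  case (Cons a w)
  then have "map (swap_weight q a) w = map (\<lambda>_. 1) w"
    by (auto simp: swap_weight_def)
  with Cons show ?case
    by (simp add: map_replicate_const)
qed simp

lemma sort_append_sort_left: "sort (sort u @ v) = sort (u @ v)"
  and sort_append_sort_right: "sort (u @ sort v) = sort (u @ v)" for u v :: "nat list"
  by (rule properties_for_sort; simp)+

definition normal_form :: "(nat \<Rightarrow> nat \<Rightarrow> 'k::comm_ring_1) \<Rightarrow> 'k free_alg \<Rightarrow> 'k free_alg" where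
  "normal_form q = word_lin (\<lambda>w c. term_of_word (sort w) (sort_weight q w * c))"

lemma normal_form_zero [simp]: "normal_form q 0 = 0"
  by (simp add: normal_form_def)

lemma normal_form_term [simp]: "normal_form q (term_of_word w c) = term_of_word (sort w) (sort_weight q w * c)"
  by (simp add: normal_form_def)

lemma normal_form_add: "normal_form q (f + g) = normal_form q f + normal_form q g"
  unfolding normal_form_def by (rule word_lin_add) (simp_all add: distrib_left single_add)

lemma normal_form_uminus: "normal_form q (- f) = - normal_form q f"
  using normal_form_add[of q f "- f"] by (simp add: eq_neg_iff_add_eq_0 add.commute)

lemma normal_form_diff: "normal_form q (f - g) = normal_form q f - normal_form q g"
  using normal_form_add[of q f "- g"] by (simp add: normal_form_uminus)

lemma normal_form_sum: "normal_form q (sum f A) = (\<Sum>a\<in>A. normal_form q (f a))"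
  by (induction A rule: infinite_finite_induct) (simp_all add: normal_form_add)

lemma normal_form_const_mult: "normal_form q (const c * f) = const c * normal_form q f"
  using wpolys_True
  by (rule additive_eqI)
    (simp_all add: normal_form_add distrib_left mult_single zero_eq_Word mult_ac)

lemma normal_form_sorted: "f \<in> wpolys sorted \<Longrightarrow> normal_form q f = f"
  by (rule additive_eqI[where P = sorted])
    (simp_all add: normal_form_add sort_weight_sorted sort_key_id_if_sorted sorted_sort_id)

lemma normal_form_wpolys:
  assumes "f \<in> wpolys P" "\<And>w. P w \<Longrightarrow> Q (sort w)"
  shows "normal_form q f \<in> wpolys Q"
  using assms(1)
  by (induction rule: wpolys_induct) (simp_all add: normal_form_add wpolys_add wpolys_term assms)

lemma sorted_normal_form: "normal_form q f \<in> wpolys sorted"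
  by (rule normal_form_wpolys[OF wpolys_True]) simp

lemma normal_form_idem [simp]: "normal_form q (normal_form q f) = normal_form q f"
  by (simp add: normal_form_sorted sorted_normal_form)

text \<open>On words: sorting \<open>u\<close> first only pays \<open>sort_weight q u\<close>
  earlier, and the crossings with \<open>v\<close> cost the same. With its mirror image this makes
  the kernel of \<open>normal_form q\<close> a two-sided ideal.\<close>

lemma normal_form_mult_left: "normal_form q (normal_form q f * g) = normal_form q (f * g)"
proof (rule additive_eqI[OF wpolys_True, of _ _ f], goal_cases)
  case (5 u c)
  show ?case
  proof (rule additive_eqI[OF wpolys_True, of _ _ g], goal_cases)
    case (5 v d)
    show ?case
      by (simp add: mult_single sort_weight_append sort_weight_sorted sort_append_sort_left
          cross_weight_cong[OF mset_sort refl] mult_ac)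
  qed (simp_all add: normal_form_add distrib_left)
qed (simp_all add: normal_form_add distrib_right)

lemma normal_form_mult_right: "normal_form q (f * normal_form q g) = normal_form q (f * g)"
proof (rule additive_eqI[OF wpolys_True, of _ _ f], goal_cases)
  case (5 u c)
  show ?case
  proof (rule additive_eqI[OF wpolys_True, of _ _ g], goal_cases)
    case (5 v d)
    show ?case
      by (simp add: mult_single sort_weight_append sort_weight_sorted sort_append_sort_right
          cross_weight_cong[OF refl mset_sort] mult_ac)
  qed (simp_all add: normal_form_add distrib_left)
qed (simp_all add: normal_form_add distrib_right)

section \<open>The free algebra as a ring\<close>

lemma carrier_free_algebra: "carrier (free_algebra n) = wpolys (\<lambda>w. set w \<subseteq> {1..n})"
  by (auto simp: free_algebra_def wpolys_def)

lemma free_algebra_simps [simp]: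
  "f \<otimes>\<^bsub>free_algebra n\<^esub> g = f * g" "\<one>\<^bsub>free_algebra n\<^esub> = 1"
  "f \<oplus>\<^bsub>free_algebra n\<^esub> g = f + g" "\<zero>\<^bsub>free_algebra n\<^esub> = 0"
  by (simp_all add: free_algebra_def)

lemma free_algebra_ring: "ring (free_algebra n :: ('k::field free_alg) ring)"
proof (rule ringI)
  let ?F = "free_algebra n :: ('k free_alg) ring"
  show "abelian_group ?F"
  proof (rule abelian_groupI)
    fix f :: "'k free_alg"
    assume "f \<in> carrier ?F"
    then show "\<exists>g\<in>carrier ?F. g \<oplus>\<^bsub>?F\<^esub> f = \<zero>\<^bsub>?F\<^esub>"
      by (intro bexI[of _ "- f"]) (simp_all add: carrier_free_algebra wpolys_uminus)
  qed (simp_all add: carrier_free_algebra wpolys_add add_ac)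
  show "Group.monoid ?F"
  proof (rule monoidI)
    fix f g :: "'k free_alg"
    assume "f \<in> carrier ?F" "g \<in> carrier ?F"
    then show "f \<otimes>\<^bsub>?F\<^esub> g \<in> carrier ?F"
      unfolding free_algebra_simps carrier_free_algebra by (rule wpolys_letters_mult)
  qed (simp_all add: carrier_free_algebra wpolys_one mult.assoc)
qed (simp_all add: distrib_left distrib_right)

lemma free_algebra_a_inv:
  fixes f :: "'k::field free_alg"
  assumes "f \<in> carrier (free_algebra n)"
  shows "\<ominus>\<^bsub>free_algebra n\<^esub> f = - f"
proof -
  interpret ring "free_algebra n :: ('k free_alg) ring"
    by (rule free_algebra_ring)
  show ?thesis
    using assms by (intro minus_equality) (simp_all add: carrier_free_algebra wpolys_uminus)
qed

lemma ideal_free_algebra_iff: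
  fixes J :: "'k::field free_alg set"
  shows "ideal J (free_algebra n) \<longleftrightarrow>
    J \<subseteq> carrier (free_algebra n) \<and> 0 \<in> J \<and> (\<forall>f\<in>J. \<forall>g\<in>J. f + g \<in> J) \<and> (\<forall>f\<in>J. - f \<in> J) \<and>
    (\<forall>f\<in>J. \<forall>g\<in>carrier (free_algebra n). f * g \<in> J \<and> g * f \<in> J)" (is "?L \<longleftrightarrow> ?R")
proof
  assume ?L
  then interpret ideal J "free_algebra n" .
  have "- f \<in> J" if "f \<in> J" for f
    using additive_subgroup.a_inv_closed[OF additive_subgroup_axioms that] that a_subset by (simp add: free_algebra_a_inv subset_iff)
  moreover have "f + g \<in> J" if "f \<in> J" "g \<in> J" for f g
    using additive_subgroup.a_closed[OF additive_subgroup_axioms that] by simp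
  moreover have "f * g \<in> J \<and> g * f \<in> J" if "f \<in> J" "g \<in> carrier (free_algebra n)" for f g
    using I_l_closed[OF that] I_r_closed[OF that] by simp
  moreover have "0 \<in> J"
    using additive_subgroup.zero_closed[OF additive_subgroup_axioms] by simp
  ultimately show ?R
    using a_subset by (intro conjI ballI) simp_all
next
  assume R: ?R
  interpret ring "free_algebra n :: ('k free_alg) ring"
    by (rule free_algebra_ring)
  have inv: "inv\<^bsub>add_monoid (free_algebra n)\<^esub> f = - f" if "f \<in> J" for f
    using R that free_algebra_a_inv[of f n] by (auto simp: a_inv_def)
  show ?L
  proof (rule idealI[OF free_algebra_ring])
    show "subgroup J (add_monoid (free_algebra n))"
    proof (rule subgroup.intro)
      show "inv\<^bsub>add_monoid (free_algebra n)\<^esub> f \<in> J" if "f \<in> J" for f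
        unfolding inv[OF that] using R that by blast
    qed (use R in auto)
  qed (use R in auto)
qed

section \<open>Rewriting into sorted words modulo an ideal\<close>

lemma unsorted_descent:
  fixes w :: "nat list"
  assumes "\<not> sorted w"
  shows "\<exists>u a b v. w = u @ a # b # v \<and> b < a"
  using assms
proof (induction w rule: induct_list012)
  case (3 x y w)
  show ?case
  proof (cases "y < x")
    case True
    then have "x # y # w = [] @ x # y # w \<and> y < x"
      by simp
    then show ?thesis
      by blast
  next
    case False
    with 3 obtain u a b v where "y # w = u @ a # b # v" "b < a"
      by (metis linorder_not_less sorted2)
    then have "x # y # w = (x # u) @ a # b # v \<and> b < a"
      by simp
    then show ?thesis
      by blast
  qed
qed simp_all

text \<open>Exchanging a descent gives a lexicographically smaller word of the same length, and the
  linear terms give shorter words, so rewriting terminates in the length-lexicographic order. Only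
  existence of \<open>g\<close> is claimed; uniqueness has to come from elsewhere. Since
  \<open>r\<close> may be zero, the lemma serves the truncated and the full relations alike.\<close>

lemma congruent_to_sorted:
  fixes J :: "'k::field free_alg set"
  assumes J: "ideal J (free_algebra n)"
    and rel: "\<And>a b. a \<in> {1..n} \<Longrightarrow> b \<in> {1..n} \<Longrightarrow> b < a \<Longrightarrow>
      \<exists>r. term_of_word [a, b] 1 - term_of_word [b, a] (q a b) + (\<Sum>k\<in>{1..n}. term_of_word [k] (r k)) \<in> J"
    and f: "f \<in> carrier (free_algebra n)"
  shows "\<exists>g\<in>wpolys (\<lambda>w. sorted w \<and> set w \<subseteq> {1..n}). f - g \<in> J"
proof -
  let ?N = "wpolys (\<lambda>w. sorted w \<and> set w \<subseteq> {1..n}) :: 'k free_alg set"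
  define W where "W = {f. \<exists>g\<in>?N. f - g \<in> J}"
  have J0: "0 \<in> J" and Jadd: "f \<in> J \<Longrightarrow> g \<in> J \<Longrightarrow> f + g \<in> J" and Jneg: "f \<in> J \<Longrightarrow> - f \<in> J"
    and Jr: "f \<in> J \<Longrightarrow> h \<in> carrier (free_algebra n) \<Longrightarrow> f * h \<in> J"
    and Jl: "f \<in> J \<Longrightarrow> h \<in> carrier (free_algebra n) \<Longrightarrow> h * f \<in> J" for f g h
    using J by (auto simp: ideal_free_algebra_iff)
  have WN: "?N \<subseteq> W"
    unfolding W_def using J0 by (metis (lifting) diff_self mem_Collect_eq subsetI)
  have WJ: "J \<subseteq> W"
    unfolding W_def by (metis (lifting) diff_zero mem_Collect_eq subsetI wpolys_zero)
  have Wadd: "f + g \<in> W" if fg: "f \<in> W" "g \<in> W" for f g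
  proof -
    obtain f' g' where "f' \<in> ?N" "g' \<in> ?N" "f - f' \<in> J" "g - g' \<in> J"
      using fg by (auto simp: W_def)
    then have "f' + g' \<in> ?N" "(f + g) - (f' + g') \<in> J"
      using Jadd[of "f - f'" "g - g'"] by (auto simp: wpolys_add algebra_simps)
    then show ?thesis
      by (auto simp: W_def)
  qed
  have Wneg: "- f \<in> W" if fW: "f \<in> W" for f
  proof -
    obtain f' where "f' \<in> ?N" "f - f' \<in> J"
      using fW by (auto simp: W_def)
    then have "- f' \<in> ?N" "- f - (- f') \<in> J"
      using Jneg[of "f - f'"] by (auto simp: wpolys_uminus)
    then show ?thesis
      unfolding W_def by blast
  qed
  have Wsum: "sum h A \<in> W" if "\<And>k. k \<in> A \<Longrightarrow> h k \<in> W" for h :: "nat \<Rightarrow> 'k free_alg" and A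
    using that WN by (induction A rule: infinite_finite_induct) (auto intro: Wadd)
  have word: "term_of_word w c \<in> W" if "set w \<subseteq> {1..n}" for w c
    using wf_lenlex[OF wf_less_than] that
  proof (induction w arbitrary: c rule: wf_induct_rule)
    case (less w)
    show ?case
    proof (cases "sorted w")
      case True
      then have "term_of_word w c \<in> ?N"
        using less.prems by (simp add: wpolys_term)
      with WN show ?thesis
        by blast
    next
      case False
      then obtain u a b v where w: "w = u @ a # b # v" and ba: "b < a"
        using unsorted_descent by blast
      obtain r where r: "term_of_word [a, b] 1 - term_of_word [b, a] (q a b) +
          (\<Sum>k\<in>{1..n}. term_of_word [k] (r k)) \<in> J" (is "?\<rho> \<in> J")
        using rel[of a b] ba less.prems by (auto simp: w)
      let ?S = "\<Sum>k\<in>{1..n}. term_of_word (u @ k # v) (c * r k)"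
      have "term_of_word u c \<in> carrier (free_algebra n)" "term_of_word v 1 \<in> carrier (free_algebra n)"
        using less.prems by (auto simp: w carrier_free_algebra intro!: wpolys_term)
      \<comment> \<open>The relation, multiplied by the letters around the descent, lies in the
        ideal; it expresses \<open>w\<close> by words covered by the induction hypothesis.\<close>
      then have "term_of_word u c * ?\<rho> * term_of_word v 1 \<in> W"
        using r Jl Jr WJ by blast
      also have "term_of_word u c * ?\<rho> * term_of_word v 1
          = term_of_word w c - term_of_word (u @ b # a # v) (c * q a b) + ?S"
        by (simp add: w distrib_left distrib_right sum_distrib_left sum_distrib_right
            left_diff_distrib right_diff_distrib mult_single)
      finally have rho: "term_of_word w c - term_of_word (u @ b # a # v) (c * q a b) + ?S \<in> W" .
      have "term_of_word (u @ b # a # v) (c * q a b) \<in> W"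
        using less.prems ba by (intro less.IH) (auto simp: w Cons_lenlex_iff irrefl_less_than)
      moreover have "- ?S \<in> W"
        using less.prems by (intro Wneg Wsum less.IH) (auto simp: w lenlex_conv)
      ultimately have "term_of_word w c - term_of_word (u @ b # a # v) (c * q a b) + ?S
          + term_of_word (u @ b # a # v) (c * q a b) + - ?S \<in> W"
        using Wadd[OF Wadd[OF rho]] by blast
      then show ?thesis
        by simp
    qed
  qed
  have "f \<in> W"
    using f unfolding carrier_free_algebra
  proof (induction rule: wpolys_induct)
    case zero
    show ?case
      using WN wpolys_zero by blast
  qed (fact Wadd, fact word)
  then show ?thesis
    by (auto simp: W_def)
qed

lemma normal_form_mult_eq_0:
  assumes "normal_form q f = 0"
  shows "normal_form q (f * g) = 0" "normal_form q (g * f) = 0"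
proof -
  have "normal_form q (f * g) = normal_form q (0 * g)"
    using normal_form_mult_left[of q f g] unfolding assms by (rule sym)
  then show "normal_form q (f * g) = 0"
    by simp
  have "normal_form q (g * f) = normal_form q (g * 0)"
    using normal_form_mult_right[of q g f] unfolding assms by (rule sym)
  then show "normal_form q (g * f) = 0"
    by simp
qed

text \<open>Sorting kills the generators and its kernel is an ideal, which gives one inclusion.
  Conversely, rewriting turns \<open>f\<close> into a sorted \<open>g\<close> modulo the generated
  ideal; sorting kills \<open>f\<close> and \<open>f - g\<close> but fixes \<open>g\<close>, so
  \<open>g = 0\<close>. The relations for \<open>b < a\<close> drive the rewriting; \<open>S\<close>
  may contain others that sorting kills.\<close>

lemma quantum_relations_generate_kernel:
  fixes S :: "'k::field free_alg set"
  assumes S: "S \<subseteq> carrier (free_algebra n)" "\<And>f. f \<in> S \<Longrightarrow> normal_form q f = 0"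
    and rel: "\<And>a b. a \<in> {1..n} \<Longrightarrow> b \<in> {1..n} \<Longrightarrow> b < a \<Longrightarrow>
      term_of_word [a, b] 1 - term_of_word [b, a] (q a b) \<in> S"
  shows "Idl\<^bsub>free_algebra n\<^esub> S = {f \<in> carrier (free_algebra n). normal_form q f = 0}"
proof -
  interpret ring "free_algebra n :: ('k free_alg) ring"
    by (rule free_algebra_ring)
  have "ideal {f \<in> carrier (free_algebra n). normal_form q f = 0} (free_algebra n)"
    unfolding ideal_free_algebra_iff carrier_free_algebra
    by (auto simp: wpolys_add wpolys_uminus normal_form_add normal_form_uminus normal_form_mult_eq_0 wpolys_letters_mult)
  then have "Idl\<^bsub>free_algebra n\<^esub> S \<subseteq> {f \<in> carrier (free_algebra n). normal_form q f = 0}"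
    using S by (intro genideal_minimal) auto
  moreover have "f \<in> Idl\<^bsub>free_algebra n\<^esub> S" if f: "f \<in> carrier (free_algebra n)" "normal_form q f = 0" for f
  proof -
    have "\<exists>g\<in>wpolys (\<lambda>w. sorted w \<and> set w \<subseteq> {1..n}). f - g \<in> Idl\<^bsub>free_algebra n\<^esub> S"
    proof (rule congruent_to_sorted[where q = q])
      fix a b
      assume "a \<in> {1..n}" "b \<in> {1..n}" "b < a"
      then have "term_of_word [a, b] 1 - term_of_word [b, a] (q a b) + (\<Sum>k\<in>{1..n}. term_of_word [k] 0) \<in> S"
        using rel by simp
      then show "\<exists>r. term_of_word [a, b] 1 - term_of_word [b, a] (q a b)
          + (\<Sum>k\<in>{1..n}. term_of_word [k] (r k)) \<in> Idl\<^bsub>free_algebra n\<^esub> S"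
        using genideal_self[OF S(1)] by (intro exI[of _ "\<lambda>_. 0"]) blast
    qed (use genideal_ideal[OF S(1)] f in auto)
    then obtain g where g: "g \<in> wpolys (\<lambda>w. sorted w \<and> set w \<subseteq> {1..n})" "f - g \<in> Idl\<^bsub>free_algebra n\<^esub> S"
      by blast
    have "g \<in> wpolys sorted"
      using g(1) by (rule wpolys_mono) simp
    moreover have "normal_form q (f - g) = 0"
      using \<open>Idl\<^bsub>free_algebra n\<^esub> S \<subseteq> _\<close> g(2) by auto
    ultimately have "g = 0"
      using f(2) by (simp add: normal_form_diff normal_form_sorted)
    with g(2) show ?thesis
      by simp
  qed
  ultimately show ?thesis
    by blast
qed

section \<open>The Koszul complex and its contracting homotopy\<close>

abbreviation var :: "nat \<Rightarrow> 'k::zero_neq_one free_alg" where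
  "var s \<equiv> term_of_word [s] 1"

text \<open>Undoes right multiplication by \<open>var m\<close> on sorted words with no letter above
  \<open>m\<close>. This is the coordinate form of the homotopy.\<close>

definition peel :: "nat \<Rightarrow> 'k::comm_monoid_add free_alg \<Rightarrow> 'k free_alg" where
  "peel m = word_lin (\<lambda>w c. if w \<noteq> [] \<and> last w = m then term_of_word (butlast w) c else 0)"

lemma peel_zero [simp]: "peel m 0 = 0"
  by (simp add: peel_def)

lemma peel_term [simp]:
  "peel m (term_of_word w c) = (if w \<noteq> [] \<and> last w = m then term_of_word (butlast w) c else 0)"
  by (simp add: peel_def)

lemma peel_add: "peel m (f + g) = peel m f + peel m g"
  unfolding peel_def by (rule word_lin_add) (simp_all add: single_add)

lemma peel_sum: "peel m (sum f A) = (\<Sum>a\<in>A. peel m (f a))"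
  by (induction A rule: infinite_finite_induct) (simp_all add: peel_add)

lemma peel_const_mult: "peel m (const c * f) = const c * peel m f"
  for f :: "'k::comm_ring_1 free_alg"
  using wpolys_True
  by (rule additive_eqI) (simp_all add: peel_add distrib_left mult_single zero_eq_Word)

lemma peel_wpolys:
  assumes "f \<in> wpolys P" "\<And>w. P (w @ [m]) \<Longrightarrow> Q w"
  shows "peel m f \<in> wpolys Q"
  using assms(1)
proof (induction rule: wpolys_induct)
  case (word w c)
  with assms(2) show ?case
    by (cases w rule: rev_cases) (auto intro: wpolys_term)
qed (simp_all add: peel_add wpolys_add)

lemma const_mult_commute: "const c * f = f * const c" for f :: "'k::comm_ring_1 free_alg"
  using wpolys_True
  by (rule additive_eqI) (simp_all add: distrib_left distrib_right mult_single zero_eq_Word mult.commute)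

lemma sort_snoc_snoc_max:
  fixes w :: "nat list"
  assumes "\<And>a. a \<in> set w \<Longrightarrow> a \<le> m" "t \<le> m"
  shows "sort (w @ [m, t]) = sort (w @ [t]) @ [m]"
  by (rule properties_for_sort) (use assms in \<open>auto simp: sorted_append\<close>)

text \<open>No letter of \<open>w\<close> exceeds \<open>m\<close>, so none of them pays for
  standing before \<open>m\<close>; the only extra cost is the exchange of \<open>m\<close> with
  \<open>t\<close>.\<close>

lemma sort_weight_snoc_snoc_max:
  assumes "sorted (w @ [m])" "t < m"
  shows "sort_weight q (w @ [m, t]) = q m t * sort_weight q (w @ [t])"
proof -
  have "(\<Prod>a\<leftarrow>w. swap_weight q a m * swap_weight q a t) = (\<Prod>a\<leftarrow>w. swap_weight q a t)"
    by (rule arg_cong[where f = prod_list])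
      (use assms(1) in \<open>auto simp: sorted_append swap_weight_def\<close>)
  moreover have "swap_weight q m t = q m t"
    using assms(2) by (simp add: swap_weight_def)
  ultimately show ?thesis
    by (simp add: sort_weight_append cross_weight_def mult_ac)
qed

lemma le_last_sort: "a \<in> set w \<Longrightarrow> a \<le> last (sort w)" for w :: "nat list"
proof -
  assume a: "a \<in> set w"
  then have "sort w = butlast (sort w) @ [last (sort w)]"
    by (metis append_butlast_last_id empty_iff list.set(1) set_sort)
  moreover have "sorted (sort w)"
    by simp
  ultimately have "\<forall>b\<in>set (sort w). b \<le> last (sort w)"
    by (metis UnE empty_iff insertE list.set(1) list.simps(15) order.refl set_append sorted_append list.set_intros(1))
  with a show ?thesis
    by simp
qed

abbreviation normal_polys :: "nat \<Rightarrow> 'k::zero free_alg set" where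
  "normal_polys n \<equiv> wpolys (\<lambda>w. sorted w \<and> set w \<subseteq> {1..n})"

text \<open>A sorted word whose last letter exceeds \<open>M\<close> is rebuilt by peeling that
  letter and multiplying it back; any other word, the empty one included, survives multiplication by
  \<open>var M\<close> followed by peeling \<open>M\<close>. Each word is produced by exactly one of
  the two summands.\<close>

lemma sum_peel_above:
  fixes f :: "'k::comm_ring_1 free_alg"
  assumes "f \<in> normal_polys n"
  shows "(\<Sum>s\<in>{s\<in>{1..n}. M < s}. normal_form q (peel s f * var s)) + peel M (normal_form q (f * var M)) = f"
  using assms
proof (rule additive_eqI[where G = "\<lambda>f. f"], goal_cases)
  case (5 w c)
  show ?case
  proof (cases w rule: rev_cases)
    case Nil
    then show ?thesis
      by (simp add: mult_single)
  next
    case (snoc w' m)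
    have "(\<Sum>s\<in>{s\<in>{1..n}. M < s}. normal_form q (peel s (term_of_word w c) * var s))
        = (\<Sum>s\<in>{s\<in>{1..n}. M < s}. if s = m then term_of_word w c else 0)"
      using 5 by (intro sum.cong)
        (auto simp: snoc mult_single sorted_sort_id sort_weight_sorted)
    also have "\<dots> = (if M < m then term_of_word w c else 0)"
      using 5 by (auto simp: snoc)
    finally have 1: "(\<Sum>s\<in>{s\<in>{1..n}. M < s}. normal_form q (peel s (term_of_word w c) * var s))
        = (if M < m then term_of_word w c else 0)" .
    show ?thesis
    proof (cases "M < m")
      case True
      then have "peel M (normal_form q (term_of_word w c * var M)) = 0"
        using 5 by (simp add: snoc mult_single sort_snoc_snoc_max sorted_append)
      with 1 True show ?thesis
        by simp
    next
      case False
      then have "sorted (w @ [M])"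
        using 5 by (fastforce simp: snoc sorted_append)
      with 1 False show ?thesis
        by (simp add: mult_single sorted_sort_id sort_weight_sorted)
    qed
  qed
qed (simp_all add: peel_add normal_form_add distrib_right sum.distrib add_ac)

text \<open>The counterpart of \<open>sum_peel_above\<close> for the empty set, where no maximum
  bounds the letters: only the empty word has no last letter to peel, so the constant term is
  missing. This defect is the augmentation.\<close>

lemma sum_peel:
  fixes f :: "'k::comm_ring_1 free_alg"
  assumes "f \<in> normal_polys n"
  shows "(\<Sum>s\<in>{1..n}. normal_form q (peel s f * var s)) = f - const (coeff f [])"
  using assms
proof (rule additive_eqI, goal_cases)
  case (5 w c)
  show ?case
  proof (cases w rule: rev_cases)
    case Nil
    then show ?thesis
      by (simp add: zero_eq_Word)
  next
    case (snoc w' m)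
    have "(\<Sum>s\<in>{1..n}. normal_form q (peel s (term_of_word w c) * var s))
        = (\<Sum>s\<in>{1..n}. if s = m then term_of_word w c else 0)"
      using 5 by (intro sum.cong)
        (auto simp: snoc mult_single sorted_sort_id sort_weight_sorted)
    then show ?thesis
      using 5 by (auto simp: snoc lookup_single)
  qed
qed (simp_all add: peel_add normal_form_add distrib_right sum.distrib lookup_add single_add)

text \<open>After sorting, the last letter is at least \<open>t\<close>, hence not
  \<open>M\<close>.\<close>

lemma peel_mult_var_above:
  fixes f :: "'k::comm_ring_1 free_alg"
  assumes "M < t"
  shows "peel M (normal_form q (f * var t)) = 0"
  using wpolys_True
proof (rule additive_eqI[where F = "\<lambda>f. peel M (normal_form q (f * var t))" and G = "\<lambda>_. 0"], goal_cases)
  case (5 w c)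
  then show ?case
    using le_last_sort[of t "w @ [t]"] assms by (auto simp: mult_single)
qed (simp_all add: peel_add normal_form_add distrib_right)

text \<open>If the word ends in \<open>M\<close>, the new letter \<open>t\<close> has to pass that
  \<open>M\<close>, at the price \<open>q M t\<close>. Otherwise both sides vanish.\<close>

lemma peel_mult_var_below:
  fixes f :: "'k::comm_ring_1 free_alg"
  assumes "f \<in> normal_polys n" "t < M"
  shows "peel M (normal_form q (f * var t)) = const (q M t) * normal_form q (peel M f * var t)"
  using assms(1)
proof (rule additive_eqI, goal_cases)
  case (5 w c)
  show ?case
  proof (cases w rule: rev_cases)
    case Nil
    then show ?thesis
      using assms(2) by (simp add: mult_single)
  next
    case (snoc w' m)
    have le: "\<And>a. a \<in> set w' \<Longrightarrow> a \<le> m"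
      using 5 by (auto simp: snoc sorted_append)
    show ?thesis
    proof (cases "m = M")
      case True
      then show ?thesis
        using 5 assms(2) le
        by (simp add: snoc mult_single sort_snoc_snoc_max sort_weight_snoc_snoc_max zero_eq_Word mult_ac)
    next
      case False
      \<comment> \<open>Sorting puts the larger of \<open>m\<close> and \<open>t\<close> last, and
        neither of them is \<open>M\<close>.\<close>
      have "last (sort (w' @ [m, t])) \<noteq> M"
      proof (cases "t \<le> m")
        case True
        with False le show ?thesis
          by (simp add: sort_snoc_snoc_max)
      next
        case False
        then have "sorted (w' @ [m, t])"
          using 5 by (fastforce simp: snoc sorted_append)
        with assms(2) show ?thesis
          by (simp add: sorted_sort_id)
      qed
      with False show ?thesis
        by (simp add: snoc mult_single)
    qed
  qed
qed (simp_all add: peel_add normal_form_add distrib_right distrib_left)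

text \<open>An element \<open>\<Sum>\<^sub>S p S e\<^sub>S\<close> of the Koszul complex, with \<open>S\<close> ranging over subsets of \<open>{1..n}\<close>, is
  represented by the function \<open>p\<close>. The differential maps \<open>e\<^sub>S\<close> to the sum over \<open>s \<in> S\<close> of
  \<open>koszul_coeff q s S x\<^sub>s e\<^bsub>S - {s}\<^esub>\<close>; the coefficients make consecutive differentials cancel.\<close>

definition koszul_coeff :: "(nat \<Rightarrow> nat \<Rightarrow> 'k::comm_ring_1) \<Rightarrow> nat \<Rightarrow> nat set \<Rightarrow> 'k" where
  "koszul_coeff q s S = (\<Prod>u\<in>{u\<in>S. s < u}. - q u s)"

text \<open>Indexed by the target: the component at \<open>S\<close> collects what comes from the
  sets \<open>insert s S\<close>. The coefficient may be taken at \<open>S\<close> instead of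
  \<open>insert s S\<close>, because only elements strictly above \<open>s\<close> count. Variables
  stand on the right to make the map left linear.\<close>

definition koszul_diff ::
  "(nat \<Rightarrow> nat \<Rightarrow> 'k::comm_ring_1) \<Rightarrow> nat \<Rightarrow> (nat set \<Rightarrow> 'k free_alg) \<Rightarrow> nat set \<Rightarrow> 'k free_alg" where
  "koszul_diff q n p S = (\<Sum>s\<in>{1..n} - S. const (koszul_coeff q s S) * p (insert s S) * var s)"

text \<open>The homotopy maps \<open>x\<^sub>w x\<^sub>m e\<^sub>S\<close>, where \<open>w m\<close> is a sorted word, to \<open>x\<^sub>w e\<^bsub>S \<union> {m}\<^esub>\<close> if \<open>m\<close> exceeds
  all elements of \<open>S\<close>, and to \<open>0\<close> otherwise.\<close>

definition koszul_homotopy :: "(nat set \<Rightarrow> 'k::comm_ring_1 free_alg) \<Rightarrow> nat set \<Rightarrow> 'k free_alg" where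
  "koszul_homotopy p S = (if S = {} then 0 else peel (Max S) (p (S - {Max S})))"

lemma koszul_coeff_empty [simp]: "koszul_coeff q s {} = 1"
  by (simp add: koszul_coeff_def)

lemma koszul_coeff_above: "(\<And>u. u \<in> S \<Longrightarrow> u \<le> s) \<Longrightarrow> koszul_coeff q s S = 1"
  unfolding koszul_coeff_def by (rule prod.neutral) fastforce

lemma koszul_coeff_insert_above:
  assumes "finite S" "m \<notin> S" "s < m"
  shows "koszul_coeff q s (insert m S) = - q m s * koszul_coeff q s S"
proof -
  have "{u \<in> insert m S. s < u} = insert m {u \<in> S. s < u}"
    using assms by auto
  then show ?thesis
    using assms by (simp add: koszul_coeff_def)
qed

lemma koszul_coeff_insert_below: "m \<le> s \<Longrightarrow> koszul_coeff q s (insert m S) = koszul_coeff q s S"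
  unfolding koszul_coeff_def by (rule arg_cong[where f = "prod _"]) auto

lemma normal_form_mult_var_var:
  assumes "t < s"
  shows "normal_form q (f * var s * var t) = const (q s t) * normal_form q (f * var t * var s)"
proof -
  have "normal_form q (f * var s * var t) = normal_form q (f * normal_form q (var s * var t))"
    by (simp only: normal_form_mult_right mult.assoc)
  also have "normal_form q (var s * var t) = const (q s t) * (var t * var s)"
    using assms by (simp add: mult_single zero_eq_Word swap_weight_def)
  also have "f * (const (q s t) * (var t * var s)) = const (q s t) * (f * var t * var s)"
    by (simp only: mult.assoc const_mult_commute[of "q s t"])
  finally show ?thesis
    by (simp only: normal_form_const_mult)
qed

text \<open>The two orders of removing \<open>s\<close> and \<open>t\<close> cancel: for
  \<open>t < s\<close> one order picks up \<open>- q s t\<close> from its coefficient, the other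
  \<open>q s t\<close> from sorting \<open>var s * var t\<close>.\<close>

lemma koszul_diff_diff:
  assumes "S \<subseteq> {1..n}"
  shows "normal_form q (koszul_diff q n (koszul_diff q n p) S) = 0"
proof -
  have fin: "finite S"
    using assms by (rule finite_subset) simp
  let ?C = "{1..n} - S"
  \<comment> \<open>The contribution in which \<open>t\<close> is removed first and \<open>s\<close>
    second.\<close>
  define A where "A s t = const (koszul_coeff q s S * koszul_coeff q t (insert s S)) *
    normal_form q (p (insert t (insert s S)) * var t * var s)" for s t
  have cancel: "A s t + A t s = 0" if "s \<in> ?C" "t \<in> ?C" "t < s" for s t
  proof -
    have "A t s = const (koszul_coeff q t S * koszul_coeff q s S * q s t) *
        normal_form q (p (insert t (insert s S)) * var t * var s)"
      using that by (simp add: A_def koszul_coeff_insert_below normal_form_mult_var_var insert_commute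
          mult_single flip: mult.assoc)
    moreover have "A s t = const (- (koszul_coeff q t S * koszul_coeff q s S * q s t)) *
        normal_form q (p (insert t (insert s S)) * var t * var s)"
      using that fin by (simp add: A_def koszul_coeff_insert_above mult_ac)
    ultimately show ?thesis
      by (simp add: single_uminus)
  qed
  have "normal_form q (koszul_diff q n (koszul_diff q n p) S) = (\<Sum>s\<in>?C. \<Sum>t\<in>{1..n} - insert s S. A s t)"
  proof -
    have "normal_form q (const a * (const b * f * g) * h) = const (a * b) * normal_form q (f * g * h)"
      for a b and f g h :: "'a free_alg"
    proof -
      have "const a * (const b * f * g) * h = const (a * b) * (f * g * h)"
        by (simp add: mult_single flip: mult.assoc)
      then show ?thesis
        by (simp only: normal_form_const_mult)
    qed
    then show ?thesis
      unfolding koszul_diff_def A_def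
      by (simp add: sum_distrib_left sum_distrib_right normal_form_sum)
  qed
  also have "\<dots> = (\<Sum>s\<in>?C. (\<Sum>t\<in>{t\<in>?C. t < s}. A s t) + (\<Sum>t\<in>{t\<in>?C. s < t}. A s t))"
  proof (rule sum.cong[OF refl])
    fix s
    have split: "{1..n} - insert s S = {t\<in>?C. t < s} \<union> {t\<in>?C. s < t}"
      by auto
    show "(\<Sum>t\<in>{1..n} - insert s S. A s t) = (\<Sum>t\<in>{t\<in>?C. t < s}. A s t) + (\<Sum>t\<in>{t\<in>?C. s < t}. A s t)"
      unfolding split by (rule sum.union_disjoint) auto
  qed
  also have "\<dots> = (\<Sum>s\<in>?C. \<Sum>t\<in>{t\<in>?C. t < s}. A s t) + (\<Sum>s\<in>?C. \<Sum>t\<in>{t\<in>?C. s < t}. A s t)"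
    by (rule sum.distrib)
  \<comment> \<open>Interchanging the two indices brings both halves to the range
    \<open>t < s\<close>, where \<open>cancel\<close> applies.\<close>
  also have "(\<Sum>s\<in>?C. \<Sum>t\<in>{t\<in>?C. s < t}. A s t) = (\<Sum>s\<in>?C. \<Sum>t\<in>{t\<in>?C. t < s}. A t s)"
    by (rule sum.swap_restrict) auto
  also have "(\<Sum>s\<in>?C. \<Sum>t\<in>{t\<in>?C. t < s}. A s t) + (\<Sum>s\<in>?C. \<Sum>t\<in>{t\<in>?C. t < s}. A t s)
      = (\<Sum>s\<in>?C. \<Sum>t\<in>{t\<in>?C. t < s}. A s t + A t s)"
    by (simp add: sum.distrib)
  also have "\<dots> = 0"
    by (intro sum.neutral ballI) (use cancel in auto)
  finally show ?thesis .
qed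

text \<open>For nonempty \<open>S\<close> with maximum \<open>M\<close>, split the missing indices
  at \<open>M\<close>. Indices below \<open>M\<close> occur in both compositions with opposite
  signs, by \<open>koszul_coeff_insert_above\<close> and \<open>peel_mult_var_below\<close>. What is
  left are the indices above \<open>M\<close> in the first composition and the index
  \<open>M\<close> in the second, and these add up to \<open>p S\<close> by
  \<open>sum_peel_above\<close>.\<close>

lemma koszul_homotopy_identity:
  fixes p :: "nat set \<Rightarrow> 'k::comm_ring_1 free_alg"
  assumes p: "\<And>T. p T \<in> normal_polys n" and S: "S \<subseteq> {1..n}"
  shows "normal_form q (koszul_diff q n (koszul_homotopy p) S)
      + koszul_homotopy (\<lambda>T. normal_form q (koszul_diff q n p T)) S
    = p S - (if S = {} then const (coeff (p {}) []) else 0)"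
proof (cases "S = {}")
  case True
  then show ?thesis
    using sum_peel[OF p]
    by (simp add: koszul_diff_def koszul_homotopy_def normal_form_sum)
next
  case False
  have fin: "finite S"
    using S by (rule finite_subset) simp
  define M where "M = Max S"
  define T where "T = S - {M}"
  define A where "A = {s\<in>{1..n}. M < s}"
  define B where "B = {s\<in>{1..n} - S. s < M}"
  have M: "M \<in> S" "\<And>u. u \<in> S \<Longrightarrow> u \<le> M"
    using False fin by (auto simp: M_def)
  have ST: "S = insert M T" "finite T" "M \<notin> T"
    using M fin by (auto simp: T_def)
  have CS: "{1..n} - S = A \<union> B"
    using M by (auto simp: A_def B_def dest: M(2)) (metis linorder_neqE_nat)
  then have CT: "{1..n} - T = insert M (A \<union> B)"
    using M S by (auto simp: T_def)
  have AB: "A \<inter> B = {}" "M \<notin> A \<union> B" "finite A" "finite B"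
    by (auto simp: A_def B_def)
  \<comment> \<open>An index above \<open>M\<close> is the new maximum, so the homotopy peels it
    from \<open>p S\<close> itself.\<close>
  have hA: "koszul_homotopy p (insert s S) = peel s (p S)" "koszul_coeff q s S = 1" if "s \<in> A" for s
  proof -
    have "Max (insert s S) = s"
      using that M fin by (intro Max_eqI) (auto simp: A_def dest: M(2))
    moreover have "insert s S - {s} = S"
      using that M(2)[of s] by (auto simp: A_def)
    ultimately show "koszul_homotopy p (insert s S) = peel s (p S)"
      by (simp add: koszul_homotopy_def)
    show "koszul_coeff q s S = 1"
      using that M(2) by (intro koszul_coeff_above) (force simp: A_def)
  qed
  \<comment> \<open>An index below \<open>M\<close> leaves the maximum alone, and \<open>M\<close>
    is peeled from a neighbouring component.\<close>
  have hB: "koszul_homotopy p (insert s S) = peel M (p (insert s T))"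
    "koszul_coeff q s S = - q M s * koszul_coeff q s T" if "s \<in> B" for s
  proof -
    have "Max (insert s S) = M"
      using that M fin by (intro Max_eqI) (auto simp: B_def)
    moreover have "insert s S - {M} = insert s T"
      using that M by (auto simp: B_def T_def)
    ultimately show "koszul_homotopy p (insert s S) = peel M (p (insert s T))"
      by (simp add: koszul_homotopy_def)
    show "koszul_coeff q s S = - q M s * koszul_coeff q s T"
      using that ST by (auto simp: B_def koszul_coeff_insert_above)
  qed
  have 1: "normal_form q (koszul_diff q n (koszul_homotopy p) S)
    = (\<Sum>s\<in>A. normal_form q (peel s (p S) * var s))
      + (\<Sum>s\<in>B. const (- q M s * koszul_coeff q s T) * normal_form q (peel M (p (insert s T)) * var s))"
    unfolding koszul_diff_def CS sum.union_disjoint[OF AB(3,4,1)]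
    by (simp add: hA hB normal_form_sum normal_form_add normal_form_const_mult mult.assoc)
  have "koszul_homotopy (\<lambda>T. normal_form q (koszul_diff q n p T)) S
      = peel M (normal_form q (\<Sum>s\<in>insert M (A \<union> B). const (koszul_coeff q s T) * p (insert s T) * var s))"
    unfolding CT[symmetric] using False by (simp add: koszul_homotopy_def koszul_diff_def M_def T_def)
  also have "\<dots> = (\<Sum>s\<in>insert M (A \<union> B). const (koszul_coeff q s T) * peel M (normal_form q (p (insert s T) * var s)))"
    by (simp only: normal_form_sum peel_sum normal_form_const_mult peel_const_mult mult.assoc)
  also have "\<dots> = peel M (normal_form q (p S * var M))
      + ((\<Sum>s\<in>A. const (koszul_coeff q s T) * peel M (normal_form q (p (insert s T) * var s)))
      + (\<Sum>s\<in>B. const (koszul_coeff q s T) * peel M (normal_form q (p (insert s T) * var s))))"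
    using AB ST M(2) by (simp add: sum.union_disjoint koszul_coeff_above)
  \<comment> \<open>A larger variable multiplied in hides \<open>M\<close> from peeling.\<close>
  also have "(\<Sum>s\<in>A. const (koszul_coeff q s T) * peel M (normal_form q (p (insert s T) * var s))) = 0"
    by (intro sum.neutral ballI) (simp add: A_def peel_mult_var_above)
  also have "(\<Sum>s\<in>B. const (koszul_coeff q s T) * peel M (normal_form q (p (insert s T) * var s)))
      = (\<Sum>s\<in>B. const (q M s * koszul_coeff q s T) * normal_form q (peel M (p (insert s T)) * var s))"
    by (intro sum.cong refl)
      (simp add: B_def peel_mult_var_below[OF p] mult_single mult.commute flip: mult.assoc)
  finally have 2: "koszul_homotopy (\<lambda>T. normal_form q (koszul_diff q n p T)) S
      = peel M (normal_form q (p S * var M))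
      + (\<Sum>s\<in>B. const (q M s * koszul_coeff q s T) * normal_form q (peel M (p (insert s T)) * var s))"
    by simp
  have "(\<Sum>s\<in>B. const (- q M s * koszul_coeff q s T) * normal_form q (peel M (p (insert s T)) * var s))
      = - (\<Sum>s\<in>B. const (q M s * koszul_coeff q s T) * normal_form q (peel M (p (insert s T)) * var s))"
    by (simp add: single_uminus sum_negf)
  then show ?thesis
    using sum_peel_above[OF p[of S], where M = M and q = q] False unfolding 1 2 A_def by simp
qed

section \<open>Graded free modules over the presented algebra\<close>

text \<open>Links the sums of record-based structures to those of type classes; the map in mind
  reads off normal forms.\<close>

lemma additive_finsum:
  fixes \<rho> :: "'m \<Rightarrow> 'c::comm_monoid_add"
  assumes M: "abelian_monoid M"
    and add: "\<And>x y. x \<in> carrier M \<Longrightarrow> y \<in> carrier M \<Longrightarrow> \<rho> (x \<oplus>\<^bsub>M\<^esub> y) = \<rho> x + \<rho> y"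
    and zero: "\<rho> \<zero>\<^bsub>M\<^esub> = 0"
    and f: "f \<in> A \<rightarrow> carrier M"
  shows "\<rho> (finsum M f A) = (\<Sum>a\<in>A. \<rho> (f a))"
proof -
  interpret abelian_monoid M
    by (rule M)
  show ?thesis
    using f by (induction A rule: infinite_finite_induct) (simp_all add: zero add Pi_iff finsum_infinite)
qed

lemma additive_subgroupI_inverse:
  assumes M: "abelian_group M" and H: "H \<subseteq> carrier M" "\<zero>\<^bsub>M\<^esub> \<in> H"
    and add: "\<And>x y. x \<in> H \<Longrightarrow> y \<in> H \<Longrightarrow> x \<oplus>\<^bsub>M\<^esub> y \<in> H"
    and inv: "\<And>x. x \<in> H \<Longrightarrow> \<exists>y\<in>H. y \<oplus>\<^bsub>M\<^esub> x = \<zero>\<^bsub>M\<^esub>"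
  shows "additive_subgroup H M"
proof -
  interpret abelian_group M
    by (rule M)
  have "\<ominus>\<^bsub>M\<^esub> x \<in> H" if "x \<in> H" for x
    using inv[OF that] minus_equality that H(1) by (metis subsetD)
  then show ?thesis
    by (intro additive_subgroupI subgroup.intro) (use H add in \<open>auto simp: a_inv_def\<close>)
qed

text \<open>Finite support is not imposed, so this is the free module on \<open>K\<close> only for
  finite \<open>K\<close>, as is the case for the sets \<open>codes i\<close>.\<close>

definition free_module :: "'b ring \<Rightarrow> nat set \<Rightarrow> ('b, nat \<Rightarrow> 'b) module" where
  "free_module B K =
    \<lparr>carrier = {p. (\<forall>k. p k \<in> carrier B) \<and> (\<forall>k. k \<notin> K \<longrightarrow> p k = \<zero>\<^bsub>B\<^esub>)},
     monoid.mult = undefined, one = undefined, zero = (\<lambda>_. \<zero>\<^bsub>B\<^esub>), add = (\<lambda>p r k. p k \<oplus>\<^bsub>B\<^esub> r k),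
     smult = (\<lambda>b p k. b \<otimes>\<^bsub>B\<^esub> p k)\<rparr>"

lemma free_module_simps [simp]:
  "p \<in> carrier (free_module B K) \<longleftrightarrow> (\<forall>k. p k \<in> carrier B) \<and> (\<forall>k. k \<notin> K \<longrightarrow> p k = \<zero>\<^bsub>B\<^esub>)"
  "\<zero>\<^bsub>free_module B K\<^esub> = (\<lambda>_. \<zero>\<^bsub>B\<^esub>)"
  "p \<oplus>\<^bsub>free_module B K\<^esub> r = (\<lambda>k. p k \<oplus>\<^bsub>B\<^esub> r k)"
  "b \<odot>\<^bsub>free_module B K\<^esub> p = (\<lambda>k. b \<otimes>\<^bsub>B\<^esub> p k)"
  by (simp_all add: free_module_def)

lemma free_module_left_module:
  assumes "ring B"
  shows "left_module B (free_module B K)"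
proof -
  interpret ring B
    by (rule assms)
  show ?thesis
  proof (intro left_module.intro left_module_axioms.intro abelian_groupI assms)
    fix p
    assume "p \<in> carrier (free_module B K)"
    then show "\<exists>r\<in>carrier (free_module B K). r \<oplus>\<^bsub>free_module B K\<^esub> p = \<zero>\<^bsub>free_module B K\<^esub>"
      by (intro bexI[of _ "\<lambda>k. \<ominus>\<^bsub>B\<^esub> p k"]) (auto simp: l_neg)
  qed (auto simp: a_ac m_assoc l_distr r_distr)
qed

section \<open>Homogeneous components of word polynomials\<close>

definition degree_part :: "int \<Rightarrow> 'k::comm_monoid_add free_alg \<Rightarrow> 'k free_alg" where
  "degree_part d = word_lin (\<lambda>w c. if int (length w) = d then term_of_word w c else 0)"

lemma coeff_degree_part: "coeff (degree_part d f) w = (if int (length w) = d then coeff f w else 0)"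
  using wpolys_True
proof (rule additive_eqI[where F = "\<lambda>f. coeff (degree_part d f) w"], goal_cases)
  case 3
  show ?case
    unfolding degree_part_def by (subst word_lin_add) (simp_all add: single_add lookup_add)
qed (auto simp: degree_part_def lookup_add lookup_single when_def)

lemma coeff_eqI: "(\<And>w. coeff f w = coeff g w) \<Longrightarrow> f = g"
  by (rule poly_mapping_eqI) (metis free_monoid.exhaust_sel)

abbreviation homogeneous :: "int \<Rightarrow> 'k::zero free_alg set" where
  "homogeneous d \<equiv> wpolys (\<lambda>w. int (length w) = d)"

lemma degree_part_homogeneous: "degree_part d f \<in> homogeneous d"
  by (simp add: wpolys_iff coeff_degree_part)

lemma degree_part_wpolys: "f \<in> wpolys P \<Longrightarrow> degree_part d f \<in> wpolys P"
  by (auto simp: wpolys_iff coeff_degree_part)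

text \<open>The shift \<open>i\<close> is the degree of the basis elements of a free module: a
  coordinate of a vector of degree \<open>d\<close> has degree \<open>d - i\<close>.\<close>

lemma degree_part_unique:
  assumes "\<And>d. g d \<in> homogeneous (d - i)" "finite D" "\<And>d. d \<notin> D \<Longrightarrow> g d = 0"
  shows "degree_part (d - i) (sum g D) = g d"
proof (rule coeff_eqI)
  fix w
  have zero: "coeff (g e) w = 0" if "int (length w) \<noteq> e - i" for e
    using assms(1)[of e] that by (auto simp: wpolys_iff)
  have "coeff (sum g D) w = coeff (g d) w" if w: "int (length w) = d - i"
  proof -
    have "coeff (sum g D) w = (\<Sum>e\<in>D. if e = d then coeff (g d) w else 0)"
      unfolding lookup_sum by (rule sum.cong) (use zero w in auto)
    also have "\<dots> = coeff (g d) w"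
      using assms(2,3) by auto
    finally show ?thesis .
  qed
  then show "coeff (degree_part (d - i) (sum g D)) w = coeff (g d) w"
    using zero by (simp add: coeff_degree_part)
qed

lemma sum_degree_part:
  assumes "finite D" "\<And>w. coeff f w \<noteq> 0 \<Longrightarrow> int (length w) + i \<in> D"
  shows "(\<Sum>d\<in>D. degree_part (d - i) f) = f"
proof (rule coeff_eqI)
  fix w
  have "coeff (\<Sum>d\<in>D. degree_part (d - i) f) w = (\<Sum>d\<in>D. if d = int (length w) + i then coeff f w else 0)"
    unfolding lookup_sum by (rule sum.cong) (auto simp: coeff_degree_part)
  then show "coeff (\<Sum>d\<in>D. degree_part (d - i) f) w = coeff f w"
    using assms by auto
qed

declare One_nat_def [simp del]

text \<open>The set \<open>S\<close> enters only through its ideal, so all truncated relations can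
  be used without selecting one per pair of variables.\<close>

locale quantum_affine_space =
  fixes n :: nat and q :: "nat \<Rightarrow> nat \<Rightarrow> 'k::field" and S :: "'k free_alg set"
  assumes relations_carrier: "S \<subseteq> carrier (free_algebra n)"
    and ideal_eq_kernel: "Idl\<^bsub>free_algebra n\<^esub> S = {f \<in> carrier (free_algebra n). normal_form q f = 0}"
begin

abbreviation B where "B \<equiv> presented_algebra n S"
abbreviation GB where "GB \<equiv> presented_algebra_degree n S"

definition proj :: "'k free_alg \<Rightarrow> 'k free_alg set" where
  "proj f = Idl\<^bsub>free_algebra n\<^esub> S +>\<^bsub>free_algebra n\<^esub> f"

text \<open>The choice of preimage does not matter: two preimages of a coset differ by an element
  that sorting kills, see \<open>proj_eq_iff\<close>.\<close>

definition rep :: "'k free_alg set \<Rightarrow> 'k free_alg" where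
  "rep b = normal_form q (SOME f. f \<in> carrier (free_algebra n) \<and> b = proj f)"

lemma ideal_relations: "ideal (Idl\<^bsub>free_algebra n\<^esub> S) (free_algebra n)"
  by (rule ring.genideal_ideal[OF free_algebra_ring relations_carrier])

lemma ring_B: "ring B"
  unfolding presented_algebra_def by (rule ideal.quotient_is_ring[OF ideal_relations])

sublocale B: ring B
  by (rule ring_B)

lemma carrier_B: "carrier B = proj ` carrier (free_algebra n)"
  by (auto simp: presented_algebra_def FactRing_def A_RCOSETS_def' proj_def)

lemma proj_closed: "f \<in> carrier (free_algebra n) \<Longrightarrow> proj f \<in> carrier B"
  by (simp add: carrier_B)

lemma proj_hom:
  assumes "f \<in> carrier (free_algebra n)" "g \<in> carrier (free_algebra n)"
  shows proj_add: "proj (f + g) = proj f \<oplus>\<^bsub>B\<^esub> proj g" and proj_mult: "proj (f * g) = proj f \<otimes>\<^bsub>B\<^esub> proj g"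
  using ring_hom_add[OF ideal.rcos_ring_hom[OF ideal_relations] assms]
    ring_hom_mult[OF ideal.rcos_ring_hom[OF ideal_relations] assms]
  by (simp_all add: proj_def presented_algebra_def)

lemma proj_one: "proj 1 = \<one>\<^bsub>B\<^esub>"
  using ring_hom_one[OF ideal.rcos_ring_hom[OF ideal_relations]]
  by (simp add: proj_def presented_algebra_def)

lemma proj_eq_iff:
  assumes "f \<in> carrier (free_algebra n)" "g \<in> carrier (free_algebra n)"
  shows "proj f = proj g \<longleftrightarrow> normal_form q f = normal_form q g"
proof -
  interpret I: ideal "Idl\<^bsub>free_algebra n\<^esub> S" "free_algebra n"
    by (rule ideal_relations)
  have "proj f = proj g \<longleftrightarrow> f \<in> proj g"
    unfolding proj_def using assms I.a_rcos_self I.a_repr_independence' I.abelian_subgroup_axioms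
    by (metis abelian_subgroup.a_repr_independence')
  also have "\<dots> \<longleftrightarrow> f - g \<in> Idl\<^bsub>free_algebra n\<^esub> S"
    unfolding proj_def using I.a_rcos_module[OF assms(2,1)] assms
    by (simp add: free_algebra_a_inv)
  also have "\<dots> \<longleftrightarrow> normal_form q f = normal_form q g"
    using assms unfolding ideal_eq_kernel carrier_free_algebra
    by (simp add: wpolys_diff normal_form_diff)
  finally show ?thesis .
qed

lemma normal_form_normal_polys:
  "f \<in> carrier (free_algebra n) \<Longrightarrow> normal_form q f \<in> normal_polys n"
  unfolding carrier_free_algebra by (erule normal_form_wpolys) simp

lemma normal_polys_carrier: "f \<in> normal_polys n \<Longrightarrow> f \<in> carrier (free_algebra n)"
  unfolding carrier_free_algebra by (erule wpolys_mono) simp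

lemma normal_form_normal: "f \<in> normal_polys n \<Longrightarrow> normal_form q f = f"
  by (rule normal_form_sorted) (erule wpolys_mono, simp)

lemma rep_proj: "f \<in> carrier (free_algebra n) \<Longrightarrow> rep (proj f) = normal_form q f"
  unfolding rep_def by (rule someI2[of _ f]) (use proj_eq_iff in auto)

lemma rep_proj_normal: "f \<in> normal_polys n \<Longrightarrow> rep (proj f) = f"
  by (simp add: rep_proj normal_polys_carrier normal_form_normal)

lemma rep_normal: "b \<in> carrier B \<Longrightarrow> rep b \<in> normal_polys n"
  by (auto simp: carrier_B rep_proj normal_form_normal_polys)

lemma rep_carrier: "b \<in> carrier B \<Longrightarrow> rep b \<in> carrier (free_algebra n)"
  by (rule normal_polys_carrier[OF rep_normal])

lemma proj_rep: "b \<in> carrier B \<Longrightarrow> proj (rep b) = b"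
  unfolding carrier_B
  by (elim imageE) (simp add: rep_proj proj_eq_iff normal_polys_carrier normal_form_normal_polys)

lemma rep_inject: "b \<in> carrier B \<Longrightarrow> c \<in> carrier B \<Longrightarrow> rep b = rep c \<longleftrightarrow> b = c"
  by (metis proj_rep)

lemma free_algebra_closed:
  "f \<in> carrier (free_algebra n) \<Longrightarrow> g \<in> carrier (free_algebra n) \<Longrightarrow> f + g \<in> carrier (free_algebra n)"
  "f \<in> carrier (free_algebra n) \<Longrightarrow> g \<in> carrier (free_algebra n) \<Longrightarrow> f * g \<in> carrier (free_algebra n)"
  for f g :: "'k free_alg"
  by (simp_all add: carrier_free_algebra wpolys_add wpolys_letters_mult)

lemma rep_add: "b \<in> carrier B \<Longrightarrow> c \<in> carrier B \<Longrightarrow> rep (b \<oplus>\<^bsub>B\<^esub> c) = rep b + rep c"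
  by (auto simp: carrier_B rep_proj free_algebra_closed normal_form_add simp flip: proj_add)

lemma rep_mult: "b \<in> carrier B \<Longrightarrow> c \<in> carrier B \<Longrightarrow> rep (b \<otimes>\<^bsub>B\<^esub> c) = normal_form q (rep b * rep c)"
  by (auto simp: carrier_B rep_proj free_algebra_closed normal_form_mult_left normal_form_mult_right
      simp flip: proj_mult)

lemma rep_zero [simp]: "rep \<zero>\<^bsub>B\<^esub> = 0"
  using rep_add[of "\<zero>\<^bsub>B\<^esub>" "\<zero>\<^bsub>B\<^esub>"] by simp

lemma rep_one [simp]: "rep \<one>\<^bsub>B\<^esub> = 1"
proof -
  have "1 \<in> normal_polys n"
    by (rule wpolys_one) simp
  then show ?thesis
    using rep_proj_normal by (metis proj_one)
qed

lemma proj_zero [simp]: "proj 0 = \<zero>\<^bsub>B\<^esub>"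
  by (metis B.zero_closed proj_rep rep_zero)

lemma one_neq_zero: "\<one>\<^bsub>B\<^esub> \<noteq> \<zero>\<^bsub>B\<^esub>"
  by (metis rep_one rep_zero zero_neq_one)

text \<open>Sorting preserves length, so a homogeneous preimage may be replaced by the normal
  form.\<close>

lemma GB_iff: "b \<in> GB d \<longleftrightarrow> b \<in> carrier B \<and> rep b \<in> homogeneous d"
proof
  assume "b \<in> GB d"
  then obtain f where f: "f \<in> carrier (free_algebra n)" "f \<in> homogeneous d" "b = proj f"
    by (auto simp: presented_algebra_degree_def free_algebra_degree_def wpolys_def proj_def)
  then have "rep b \<in> homogeneous d"
    by (auto simp: rep_proj intro!: normal_form_wpolys[OF f(2)])
  then show "b \<in> carrier B \<and> rep b \<in> homogeneous d"
    using f by (auto simp: proj_closed)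
next
  assume b: "b \<in> carrier B \<and> rep b \<in> homogeneous d"
  then have "b = proj (rep b)" "rep b \<in> free_algebra_degree n d"
    using rep_carrier by (auto simp: proj_rep free_algebra_degree_def wpolys_def)
  then show "b \<in> GB d"
    unfolding presented_algebra_degree_def proj_def by blast
qed

text \<open>The shift places the unit vectors in degree \<open>i\<close>.\<close>

definition free_grading :: "nat set \<Rightarrow> int \<Rightarrow> int \<Rightarrow> (nat \<Rightarrow> 'k free_alg set) set" where
  "free_grading K i d = {p \<in> carrier (free_module B K). \<forall>k. p k \<in> GB (d - i)}"

lemma free_grading_iff:
  "p \<in> free_grading K i d \<longleftrightarrow> p \<in> carrier (free_module B K) \<and> (\<forall>k. rep (p k) \<in> homogeneous (d - i))"
  by (auto simp: free_grading_def GB_iff)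

lemma left_module_free_module: "left_module B (free_module B K)"
  by (rule free_module_left_module[OF ring_B])

lemma abelian_group_free_module: "abelian_group (free_module B K)"
  using left_module_free_module by (rule left_module.axioms)

lemma rep_finsum_free_module:
  assumes "f \<in> A \<rightarrow> carrier (free_module B K)"
  shows "rep (finsum (free_module B K) f A k) = (\<Sum>a\<in>A. rep (f a k))"
  using assms abelian_group.axioms(1)[OF abelian_group_free_module]
  by (intro additive_finsum[where \<rho> = "\<lambda>p. rep (p k)"]) (simp_all add: rep_add)

lemma free_module_eqI:
  assumes "p \<in> carrier (free_module B K)" "r \<in> carrier (free_module B K)" "\<And>k. rep (p k) = rep (r k)"
  shows "p = r"
  using assms by (auto simp: rep_inject)

lemma finsum_free_module_closed:
  assumes "f \<in> A \<rightarrow> carrier (free_module B K)"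
  shows "finsum (free_module B K) f A \<in> carrier (free_module B K)"
  by (rule abelian_monoid.finsum_closed[OF abelian_group.axioms(1)[OF abelian_group_free_module] assms])

lemma free_grading_subgroup: "additive_subgroup (free_grading K i d) (free_module B K)"
proof (rule additive_subgroupI_inverse[OF abelian_group_free_module])
  fix p
  assume p: "p \<in> free_grading K i d"
  have "- rep (p k) \<in> normal_polys n" for k
    using p by (simp add: free_grading_iff rep_normal wpolys_uminus)
  then have "rep (proj (- rep (p k))) = - rep (p k)" "proj (- rep (p k)) \<in> carrier B" for k
    by (simp_all add: rep_proj_normal proj_closed normal_polys_carrier)
  moreover from this have "proj (- rep (p k)) \<oplus>\<^bsub>B\<^esub> p k = \<zero>\<^bsub>B\<^esub>" for k
    using p by (subst rep_inject[symmetric]) (simp_all add: free_grading_iff rep_add)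
  ultimately have "(\<lambda>k. proj (- rep (p k))) \<in> free_grading K i d"
    "(\<lambda>k. proj (- rep (p k)) \<oplus>\<^bsub>B\<^esub> p k) = (\<lambda>_. \<zero>\<^bsub>B\<^esub>)"
    using p by (simp_all add: free_grading_iff wpolys_uminus)
  then show "\<exists>r\<in>free_grading K i d. r \<oplus>\<^bsub>free_module B K\<^esub> p = \<zero>\<^bsub>free_module B K\<^esub>"
    by (intro bexI[of _ "\<lambda>k. proj (- rep (p k))"]) simp_all
qed (auto simp: free_grading_iff rep_add wpolys_add)

text \<open>The components of \<open>m\<close> are the degree parts of its coordinates; they are
  unique because a sum of homogeneous polynomials of distinct degrees determines each
  summand.\<close>

lemma free_grading_direct_sum:
  assumes K: "finite K"
  shows "direct_sum_grading (free_module B K) (free_grading K i)"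
  unfolding direct_sum_grading_def
proof (intro conjI allI ballI free_grading_subgroup)
  let ?M = "free_module B K"
  fix m
  assume m: "m \<in> carrier ?M"
  define f where "f d k = proj (degree_part (d - i) (rep (m k)))" for d k
  have rep_f: "rep (f d k) = degree_part (d - i) (rep (m k))" for d k
    using m by (simp add: f_def rep_proj_normal degree_part_wpolys rep_normal)
  have f_grading: "f d \<in> free_grading K i d" for d
  proof -
    have "degree_part (d - i) (0 :: 'k free_alg) = 0"
      by (rule coeff_eqI) (simp add: coeff_degree_part)
    then show ?thesis
      using m by (auto simp: free_grading_iff rep_f degree_part_homogeneous)
        (auto simp: f_def intro!: proj_closed normal_polys_carrier degree_part_wpolys rep_normal)
  qed
  let ?D = "\<lambda>f. {d. f d \<noteq> \<zero>\<^bsub>?M\<^esub>}"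
  have supp: "int (length w) + i \<in> ?D f" if w: "coeff (rep (m k)) w \<noteq> 0" for k w
  proof -
    have "coeff (rep (f (int (length w) + i) k)) w \<noteq> 0"
      using w by (simp add: rep_f coeff_degree_part)
    then show ?thesis
      by (auto dest: fun_cong[where x = k])
  qed
  have fin: "finite (?D f)"
  proof (rule finite_subset)
    \<comment> \<open>Finitely many coordinates with finitely many words each meet only finitely
      many degrees.\<close>
    show "?D f \<subseteq> (\<Union>k\<in>K. (\<lambda>w. int (length (letters w)) + i) ` Poly_Mapping.keys (rep (m k)))"
    proof
      fix d
      assume "d \<in> ?D f"
      then obtain k where k: "f d k \<noteq> \<zero>\<^bsub>B\<^esub>"
        unfolding free_module_simps mem_Collect_eq by blast
      then have "k \<in> K"
        using f_grading[of d] by (auto simp: free_grading_iff)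
      have "rep (f d k) \<noteq> 0"
        using k f_grading[of d] rep_inject[of "f d k" "\<zero>\<^bsub>B\<^esub>"] by (simp add: free_grading_iff)
      then obtain w where "coeff (rep (f d k)) w \<noteq> 0"
        by (metis coeff_eqI lookup_zero)
      then have "int (length w) = d - i" "Word w \<in> Poly_Mapping.keys (rep (m k))"
        by (auto simp: rep_f coeff_degree_part in_keys_iff split: if_splits)
      with \<open>k \<in> K\<close> show "d \<in> (\<Union>k\<in>K. (\<lambda>w. int (length (letters w)) + i) ` Poly_Mapping.keys (rep (m k)))"
        by (auto intro!: bexI[of _ k] image_eqI[of _ _ "Word w"])
    qed
  qed (use K in simp)
  show "\<exists>!f. (\<forall>d. f d \<in> free_grading K i d) \<and> finite (?D f) \<and> m = (\<Oplus>\<^bsub>?M\<^esub>d\<in>?D f. f d)"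
  proof (rule ex1I[of _ f])
    have f: "f \<in> ?D f \<rightarrow> carrier ?M"
      using f_grading by (simp add: free_grading_iff)
    have "m = (\<Oplus>\<^bsub>?M\<^esub>d\<in>?D f. f d)"
      by (rule free_module_eqI[OF m finsum_free_module_closed[OF f]])
        (simp only: rep_finsum_free_module[OF f] rep_f sum_degree_part[OF fin supp])
    then show "(\<forall>d. f d \<in> free_grading K i d) \<and> finite (?D f) \<and> m = (\<Oplus>\<^bsub>?M\<^esub>d\<in>?D f. f d)"
      using f_grading fin by blast
  next
    fix g
    assume g: "(\<forall>d. g d \<in> free_grading K i d) \<and> finite (?D g) \<and> m = (\<Oplus>\<^bsub>?M\<^esub>d\<in>?D g. g d)"
    then have g': "g \<in> ?D g \<rightarrow> carrier ?M"
      by (simp add: free_grading_iff)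
    have rep_g: "rep (g d k) = rep (f d k)" for d k
    proof -
      have "rep (m k) = (\<Sum>d\<in>?D g. rep (g d k))"
        using g rep_finsum_free_module[OF g', of k] by metis
      then show ?thesis
        unfolding rep_f using g
        by (simp only:) (rule degree_part_unique[symmetric]; auto simp: free_grading_iff)
    qed
    show "g = f"
    proof
      fix d
      show "g d = f d"
        using g f_grading[of d] rep_g by (intro free_module_eqI) (auto simp: free_grading_iff)
    qed
  qed
qed

lemma free_graded_module:
  assumes "finite K"
  shows "graded_module B GB (free_module B K) (free_grading K i)"
  unfolding graded_module_def
proof (intro conjI allI ballI left_module_free_module free_grading_direct_sum assms)
  fix d e b m
  assume b: "b \<in> GB d" and m: "m \<in> free_grading K i e"
  have "rep (b \<otimes>\<^bsub>B\<^esub> m k) \<in> homogeneous (d + e - i)" for k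
  proof -
    have "rep b * rep (m k) \<in> homogeneous (d + e - i)"
      using b m by (intro wpolys_mult[of _ "\<lambda>w. int (length w) = d" _ "\<lambda>w. int (length w) = e - i"])
        (auto simp: GB_iff free_grading_iff)
    then have "normal_form q (rep b * rep (m k)) \<in> homogeneous (d + e - i)"
      by (rule normal_form_wpolys) simp
    then show ?thesis
      using b m by (simp add: GB_iff free_grading_iff rep_mult)
  qed
  with b m show "b \<odot>\<^bsub>free_module B K\<^esub> m \<in> free_grading K i (d + e)"
    by (auto simp: free_grading_iff GB_iff)
qed

definition unit_vector :: "nat \<Rightarrow> nat \<Rightarrow> 'k free_alg set" where
  "unit_vector k = (\<lambda>j. if j = k then \<one>\<^bsub>B\<^esub> else \<zero>\<^bsub>B\<^esub>)"

lemma unit_vector_inject: "unit_vector k = unit_vector j \<longleftrightarrow> k = j"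
  unfolding unit_vector_def fun_eq_iff using one_neq_zero by metis

lemma free_module_basis:
  assumes K: "finite K"
  shows "module_basis B (free_module B K) (unit_vector ` K)"
  unfolding module_basis_def
proof (intro conjI ballI)
  let ?M = "free_module B K" and ?E = "unit_vector ` K"
  let ?D = "\<lambda>c :: (nat \<Rightarrow> 'k free_alg set) \<Rightarrow> 'k free_alg set. {e. c e \<noteq> \<zero>\<^bsub>B\<^esub>}"
  let ?P = "\<lambda>c. (\<forall>e. c e \<in> carrier B) \<and> (\<forall>e. e \<notin> ?E \<longrightarrow> c e = \<zero>\<^bsub>B\<^esub>) \<and> finite (?D c)"
  show "?E \<subseteq> carrier ?M"
    by (auto simp: unit_vector_def)
  have closed: "(\<lambda>e. c e \<odot>\<^bsub>?M\<^esub> e) \<in> ?D c \<rightarrow> carrier ?M" if c: "?P c" for c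
  proof
    fix e
    assume "e \<in> ?D c"
    then have "e \<in> carrier ?M"
      using c \<open>?E \<subseteq> carrier ?M\<close> by blast
    with c show "c e \<odot>\<^bsub>?M\<^esub> e \<in> carrier ?M"
      by simp
  qed
  have coord: "rep ((\<Oplus>\<^bsub>?M\<^esub>e\<in>?D c. c e \<odot>\<^bsub>?M\<^esub> e) k) = rep (c (unit_vector k))"
    if c: "?P c" and "k \<in> K" for c k
  proof -
    have "rep ((\<Oplus>\<^bsub>?M\<^esub>e\<in>?D c. c e \<odot>\<^bsub>?M\<^esub> e) k) = (\<Sum>e\<in>?D c. rep ((c e \<odot>\<^bsub>?M\<^esub> e) k))"
      by (rule rep_finsum_free_module[OF closed[OF c]])
    also have "\<dots> = (\<Sum>e\<in>?D c. if e = unit_vector k then rep (c e) else 0)"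
    proof (rule sum.cong[OF refl])
      fix e
      assume "e \<in> ?D c"
      then obtain j where "e = unit_vector j"
        using c by blast
      with c show "rep ((c e \<odot>\<^bsub>?M\<^esub> e) k) = (if e = unit_vector k then rep (c e) else 0)"
        by (auto simp: unit_vector_inject) (auto simp: unit_vector_def)
    qed
    also have "\<dots> = rep (c (unit_vector k))"
      using c by auto
    finally show ?thesis .
  qed
  fix m
  assume m: "m \<in> carrier ?M"
  \<comment> \<open>Coefficients of a basis are indexed by vectors; the position of a unit vector
    can be recovered because \<open>1\<close> differs from \<open>0\<close> in
    \<open>B\<close>.\<close>
  define c where "c e = (if e \<in> ?E then m (THE k. e = unit_vector k) else \<zero>\<^bsub>B\<^esub>)" for e
  have c_unit: "c (unit_vector k) = m k" if "k \<in> K" for k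
    using that by (simp add: c_def unit_vector_inject)
  have c: "?P c"
  proof (intro conjI allI)
    show "finite (?D c)"
      by (rule finite_subset[of _ ?E]) (use K in \<open>auto simp: c_def\<close>)
  qed (use m in \<open>auto simp: c_def\<close>)
  show "\<exists>!c. (\<forall>e. c e \<in> carrier B) \<and> (\<forall>e. e \<notin> ?E \<longrightarrow> c e = \<zero>\<^bsub>B\<^esub>) \<and> finite (?D c) \<and>
      m = (\<Oplus>\<^bsub>?M\<^esub>e\<in>?D c. c e \<odot>\<^bsub>?M\<^esub> e)"
  proof (rule ex1I[of _ c])
    have "m = (\<Oplus>\<^bsub>?M\<^esub>e\<in>?D c. c e \<odot>\<^bsub>?M\<^esub> e)"
    proof (rule free_module_eqI[OF m finsum_free_module_closed[OF closed[OF c]]])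
      fix k
      show "rep (m k) = rep ((\<Oplus>\<^bsub>?M\<^esub>e\<in>?D c. c e \<odot>\<^bsub>?M\<^esub> e) k)"
        using coord[OF c, of k] c_unit[of k] m finsum_free_module_closed[OF closed[OF c]]
        by (cases "k \<in> K") simp_all
    qed
    with c show "(\<forall>e. c e \<in> carrier B) \<and> (\<forall>e. e \<notin> ?E \<longrightarrow> c e = \<zero>\<^bsub>B\<^esub>) \<and> finite (?D c) \<and>
        m = (\<Oplus>\<^bsub>?M\<^esub>e\<in>?D c. c e \<odot>\<^bsub>?M\<^esub> e)"
      by blast
  next
    fix c'
    assume c': "(\<forall>e. c' e \<in> carrier B) \<and> (\<forall>e. e \<notin> ?E \<longrightarrow> c' e = \<zero>\<^bsub>B\<^esub>) \<and> finite (?D c') \<and>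
        m = (\<Oplus>\<^bsub>?M\<^esub>e\<in>?D c'. c' e \<odot>\<^bsub>?M\<^esub> e)"
    then have P: "?P c'" and m_eq: "(\<Oplus>\<^bsub>?M\<^esub>e\<in>?D c'. c' e \<odot>\<^bsub>?M\<^esub> e) = m"
      by blast+
    show "c' = c"
    proof
      fix e
      show "c' e = c e"
      proof (cases "e \<in> ?E")
        case True
        then obtain k where k: "k \<in> K" "e = unit_vector k"
          by blast
        have "rep (m k) = rep (c' (unit_vector k))"
          using coord[OF P k(1)] unfolding m_eq .
        then show ?thesis
          using P m k by (simp add: c_unit rep_inject)
      qed (use P c in simp)
    qed
  qed
qed

lemma free_module_graded_free:
  assumes K: "finite K"
  shows "graded_free_in_degree B GB (free_module B K) (free_grading K i) i"
  unfolding graded_free_in_degree_def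
proof (intro conjI exI)
  have "1 \<in> homogeneous 0"
    by (rule wpolys_one) simp
  then show "unit_vector ` K \<subseteq> free_grading K i i"
    by (auto simp: free_grading_iff unit_vector_def)
qed (use free_graded_module[OF K] free_module_basis[OF K] in auto)

end

section \<open>The Koszul resolution\<close>

lemma normal_form_koszul_diff:
  "normal_form q (koszul_diff q n (\<lambda>T. normal_form q (p T)) T) = normal_form q (koszul_diff q n p T)"
proof -
  have "normal_form q (const a * normal_form q f * g) = normal_form q (const a * f * g)" for a f g
    by (simp only: mult.assoc normal_form_const_mult normal_form_mult_left)
  then show ?thesis
    by (simp add: koszul_diff_def normal_form_sum)
qed

lemma koszul_diff_cong:
  "(\<And>s. s \<in> {1..n} \<Longrightarrow> s \<notin> T \<Longrightarrow> p (insert s T) = r (insert s T)) \<Longrightarrow> koszul_diff q n p T = koszul_diff q n r T"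
  by (simp add: koszul_diff_def)

lemma koszul_homotopy_normal:
  fixes p :: "nat set \<Rightarrow> 'k::comm_ring_1 free_alg"
  assumes "\<And>T. p T \<in> normal_polys n"
  shows "koszul_homotopy p T \<in> normal_polys n"
proof -
  have "peel m f \<in> normal_polys n" if "f \<in> normal_polys n" for m and f :: "'k free_alg"
    using that by (rule peel_wpolys) (auto simp: sorted_append)
  with assms show ?thesis
    by (simp add: koszul_homotopy_def)
qed

context quantum_affine_space
begin

lemma koszul_diff_carrier:
  assumes "\<And>T. p T \<in> carrier (free_algebra n)"
  shows "koszul_diff q n p T \<in> carrier (free_algebra n)"
  unfolding koszul_diff_def carrier_free_algebra
proof (intro wpolys_sum wpolys_letters_mult)
  fix s
  show "const (koszul_coeff q s T) \<in> wpolys (\<lambda>w. set w \<subseteq> {1..n})"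
    unfolding zero_eq_Word by (rule wpolys_term) simp
  show "p (insert s T) \<in> wpolys (\<lambda>w. set w \<subseteq> {1..n})"
    using assms by (simp add: carrier_free_algebra)
  show "s \<in> {1..n} - T \<Longrightarrow> var s \<in> wpolys (\<lambda>w. set w \<subseteq> {1..n})"
    by (rule wpolys_term) simp
qed

text \<open>Resolutions are required to consist of functions on natural numbers, so the subsets
  indexing the exterior basis are encoded as numbers.\<close>

definition codes :: "nat \<Rightarrow> nat set" where
  "codes i = set_encode ` {T. T \<subseteq> {1..n} \<and> card T = i}"

lemma codes_iff: "k \<in> codes i \<longleftrightarrow> set_decode k \<subseteq> {1..n} \<and> card (set_decode k) = i"
proof
  assume "k \<in> codes i"
  then obtain T where "T \<subseteq> {1..n}" "card T = i" "k = set_encode T"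
    by (auto simp: codes_def)
  then show "set_decode k \<subseteq> {1..n} \<and> card (set_decode k) = i"
    using finite_subset[of T "{1..n}"] by simp
next
  assume "set_decode k \<subseteq> {1..n} \<and> card (set_decode k) = i"
  then show "k \<in> codes i"
    unfolding codes_def by (metis (mono_tags, lifting) imageI mem_Collect_eq set_decode_inverse)
qed

lemma finite_codes: "finite (codes i)"
  unfolding codes_def by simp

lemma encode_codes_iff: "T \<subseteq> {1..n} \<Longrightarrow> set_encode T \<in> codes i \<longleftrightarrow> card T = i"
  using finite_subset[of T "{1..n}"] by (simp add: codes_iff)

lemma codes_0: "codes 0 = {0}"
proof -
  have "{T. T \<subseteq> {1..n} \<and> card T = 0} = {{}}"
    using finite_subset by (fastforce simp: card_eq_0_iff)
  then show ?thesis
    by (simp add: codes_def)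
qed

abbreviation "P i \<equiv> free_module B (codes i)"
abbreviation "G i \<equiv> free_grading (codes i) (int i)"

text \<open>Reads an element of one module as an element of the whole complex; among subsets of
  \<open>{1..n}\<close> it is supported on those of the right size.\<close>

definition reps :: "(nat \<Rightarrow> 'k free_alg set) \<Rightarrow> nat set \<Rightarrow> 'k free_alg" where
  "reps p T = rep (p (set_encode T))"

definition \<delta> :: "nat \<Rightarrow> (nat \<Rightarrow> 'k free_alg set) \<Rightarrow> nat \<Rightarrow> 'k free_alg set" where
  "\<delta> i p k = (if k \<in> codes i then proj (koszul_diff q n (reps p) (set_decode k)) else \<zero>\<^bsub>B\<^esub>)"

lemma reps_normal: "p \<in> carrier (P i) \<Longrightarrow> reps p T \<in> normal_polys n"
  by (simp add: reps_def rep_normal)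

lemma reps_carrier: "p \<in> carrier (P i) \<Longrightarrow> reps p T \<in> carrier (free_algebra n)"
  by (rule normal_polys_carrier[OF reps_normal])

lemma reps_eq_0: "p \<in> carrier (P i) \<Longrightarrow> T \<subseteq> {1..n} \<Longrightarrow> card T \<noteq> i \<Longrightarrow> reps p T = 0"
  by (simp add: reps_def encode_codes_iff)

lemma \<delta>_closed: "p \<in> carrier (P (Suc i)) \<Longrightarrow> \<delta> i p \<in> carrier (P i)"
  using koszul_diff_carrier[OF reps_carrier] by (auto simp: \<delta>_def proj_closed)

lemma rep_\<delta>:
  assumes "p \<in> carrier (P (Suc i))" "k \<in> codes i"
  shows "rep (\<delta> i p k) = normal_form q (koszul_diff q n (reps p) (set_decode k))"
  using assms(2) rep_proj[OF koszul_diff_carrier[OF reps_carrier[OF assms(1)]]] by (simp add: \<delta>_def)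

text \<open>Also valid for \<open>T\<close> of the wrong size, where both sides vanish. Hence the
  homotopy identity can be applied without tracking cardinalities.\<close>

lemma reps_\<delta>:
  assumes p: "p \<in> carrier (P (Suc i))" and T: "T \<subseteq> {1..n}"
  shows "reps (\<delta> i p) T = normal_form q (koszul_diff q n (reps p) T)"
proof (cases "card T = i")
  case True
  then have "set_encode T \<in> codes i" "set_decode (set_encode T) = T"
    using T finite_subset[OF T] by (simp_all add: encode_codes_iff)
  then show ?thesis
    using rep_\<delta>[OF p, of "set_encode T"] by (simp add: reps_def)
next
  case False
  have "koszul_diff q n (reps p) T = koszul_diff q n (\<lambda>_. 0) T"
  proof (rule koszul_diff_cong)
    fix s
    assume "s \<in> {1..n}" "s \<notin> T"
    then show "reps p (insert s T) = 0"
      using T False finite_subset[OF T] by (intro reps_eq_0[OF p]) auto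
  qed
  also have "\<dots> = 0"
    by (simp add: koszul_diff_def)
  finally show ?thesis
    using reps_eq_0[OF \<delta>_closed[OF p] T False] by simp
qed

lemma P_eqI:
  assumes "p \<in> carrier (P i)" "r \<in> carrier (P i)"
    and "\<And>T. T \<subseteq> {1..n} \<Longrightarrow> card T = i \<Longrightarrow> reps p T = reps r T"
  shows "p = r"
proof (rule free_module_eqI[OF assms(1,2)])
  fix k
  show "rep (p k) = rep (r k)"
  proof (cases "k \<in> codes i")
    case True
    then show ?thesis
      using assms(3)[of "set_decode k"] by (simp add: reps_def codes_iff)
  qed (use assms(1,2) in simp)
qed

lemma \<delta>_hom: "graded_hom B (P (Suc i)) (G (Suc i)) (P i) (G i) (\<delta> i)"
  unfolding graded_hom_def
proof (intro conjI ballI allI)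
  show "\<delta> i \<in> carrier (P (Suc i)) \<rightarrow> carrier (P i)"
    using \<delta>_closed by blast
next
  fix p r
  assume p: "p \<in> carrier (P (Suc i))" and r: "r \<in> carrier (P (Suc i))"
  interpret M: abelian_group "P (Suc i)"
    by (rule abelian_group_free_module)
  interpret N: abelian_group "P i"
    by (rule abelian_group_free_module)
  show "\<delta> i (p \<oplus>\<^bsub>P (Suc i)\<^esub> r) = \<delta> i p \<oplus>\<^bsub>P i\<^esub> \<delta> i r"
  proof (rule P_eqI[OF \<delta>_closed[OF M.a_closed[OF p r]] N.a_closed[OF \<delta>_closed[OF p] \<delta>_closed[OF r]]])
    fix T
    assume T: "T \<subseteq> {1..n}"
    have "reps (p \<oplus>\<^bsub>P (Suc i)\<^esub> r) = (\<lambda>T. reps p T + reps r T)"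
      using p r by (simp add: fun_eq_iff reps_def rep_add)
    moreover have "koszul_diff q n (\<lambda>T. reps p T + reps r T) T = koszul_diff q n (reps p) T + koszul_diff q n (reps r) T"
      by (simp add: koszul_diff_def distrib_left distrib_right sum.distrib)
    moreover have "reps (\<delta> i p \<oplus>\<^bsub>P i\<^esub> \<delta> i r) T = reps (\<delta> i p) T + reps (\<delta> i r) T"
      using \<delta>_closed[OF p] \<delta>_closed[OF r] by (simp add: reps_def rep_add)
    ultimately show "reps (\<delta> i (p \<oplus>\<^bsub>P (Suc i)\<^esub> r)) T = reps (\<delta> i p \<oplus>\<^bsub>P i\<^esub> \<delta> i r) T"
      using reps_\<delta>[OF M.a_closed[OF p r] T] reps_\<delta>[OF p T] reps_\<delta>[OF r T]
      by (simp only: normal_form_add)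
  qed
next
  fix b p
  assume b: "b \<in> carrier B" and p: "p \<in> carrier (P (Suc i))"
  have bp: "b \<odot>\<^bsub>P (Suc i)\<^esub> p \<in> carrier (P (Suc i))" "b \<odot>\<^bsub>P i\<^esub> \<delta> i p \<in> carrier (P i)"
    using left_module.smult_closed[OF left_module_free_module b] p \<delta>_closed[OF p] by blast+
  show "\<delta> i (b \<odot>\<^bsub>P (Suc i)\<^esub> p) = b \<odot>\<^bsub>P i\<^esub> \<delta> i p"
  proof (rule P_eqI[OF \<delta>_closed[OF bp(1)] bp(2)])
    fix T
    assume T: "T \<subseteq> {1..n}"
    have "reps (b \<odot>\<^bsub>P (Suc i)\<^esub> p) = (\<lambda>T. normal_form q (rep b * reps p T))"
      using b p by (simp add: fun_eq_iff reps_def rep_mult)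
    \<comment> \<open>Constants are central and variables multiply on the right, so a left factor
      passes through.\<close>
    moreover have "koszul_diff q n (\<lambda>T. rep b * reps p T) T = rep b * koszul_diff q n (reps p) T"
      by (simp add: koszul_diff_def sum_distrib_left const_mult_commute mult.assoc)
    moreover have "reps (b \<odot>\<^bsub>P i\<^esub> \<delta> i p) T = normal_form q (rep b * reps (\<delta> i p) T)"
      using \<delta>_closed[OF p] b by (simp add: reps_def rep_mult)
    ultimately show "reps (\<delta> i (b \<odot>\<^bsub>P (Suc i)\<^esub> p)) T = reps (b \<odot>\<^bsub>P i\<^esub> \<delta> i p) T"
      using reps_\<delta>[OF bp(1) T] reps_\<delta>[OF p T]
      by (simp only: normal_form_koszul_diff normal_form_mult_right)
  qed
next
  fix d
  show "\<delta> i ` G (Suc i) d \<subseteq> G i d"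
  proof
    fix r
    assume "r \<in> \<delta> i ` G (Suc i) d"
    then obtain p where p: "p \<in> carrier (P (Suc i))" "\<And>k. rep (p k) \<in> homogeneous (d - int (Suc i))"
      and r: "r = \<delta> i p"
      by (auto simp: free_grading_iff)
    have "rep (\<delta> i p k) \<in> homogeneous (d - int i)" for k
    proof (cases "k \<in> codes i")
      case True
      have "koszul_diff q n (reps p) (set_decode k) \<in> homogeneous (d - int i)"
        unfolding koszul_diff_def
      proof (intro wpolys_sum)
        fix s
        show "const (koszul_coeff q s (set_decode k)) * reps p (insert s (set_decode k)) * var s
            \<in> homogeneous (d - int i)"
        proof (rule wpolys_mult)
          show "const (koszul_coeff q s (set_decode k)) * reps p (insert s (set_decode k))
              \<in> homogeneous (d - int (Suc i))"
          proof (rule wpolys_mult)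
            show "const (koszul_coeff q s (set_decode k)) \<in> wpolys (\<lambda>w. w = [])"
              unfolding zero_eq_Word by (rule wpolys_term) simp
            show "reps p (insert s (set_decode k)) \<in> homogeneous (d - int (Suc i))"
              using p(2) by (simp add: reps_def)
          qed simp
          show "var s \<in> wpolys (\<lambda>w. length w = 1)"
            by (rule wpolys_term) simp
        qed simp
      qed
      then show ?thesis
        unfolding rep_\<delta>[OF p(1) True] by (rule normal_form_wpolys) simp
    qed (simp add: \<delta>_def)
    with \<delta>_closed[OF p(1)] show "r \<in> G i d"
      unfolding r free_grading_iff by blast
  qed
qed

lemma \<delta>_\<delta>:
  assumes p: "p \<in> carrier (P (Suc (Suc i)))"
  shows "\<delta> i (\<delta> (Suc i) p) = \<zero>\<^bsub>P i\<^esub>"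
proof (rule P_eqI)
  show "\<delta> i (\<delta> (Suc i) p) \<in> carrier (P i)"
    by (rule \<delta>_closed[OF \<delta>_closed[OF p]])
  show "\<zero>\<^bsub>P i\<^esub> \<in> carrier (P i)"
    by simp
  fix T
  assume T: "T \<subseteq> {1..n}"
  have "koszul_diff q n (reps (\<delta> (Suc i) p)) T = koszul_diff q n (\<lambda>T. normal_form q (koszul_diff q n (reps p) T)) T"
    using T by (intro koszul_diff_cong reps_\<delta>[OF p]) simp
  then show "reps (\<delta> i (\<delta> (Suc i) p)) T = reps \<zero>\<^bsub>P i\<^esub> T"
    using reps_\<delta>[OF \<delta>_closed[OF p] T] koszul_diff_diff[OF T, of q "reps p"]
    by (simp add: normal_form_koszul_diff reps_def)
qed

text \<open>By the homotopy identity the homotopy applied to \<open>p\<close> is a preimage. Two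
  terms must vanish: the homotopy of the differential and the constant term. Stating the first as a
  condition on \<open>koszul_homotopy\<close> covers \<open>i = 0\<close> too, where exactness
  concerns the augmentation instead of a differential.\<close>

lemma cycle_is_boundary:
  assumes p: "p \<in> carrier (P i)"
    and cycle: "\<And>T. T \<subseteq> {1..n} \<Longrightarrow> T \<noteq> {} \<Longrightarrow> koszul_homotopy (\<lambda>T. normal_form q (koszul_diff q n (reps p) T)) T = 0"
    and aug: "i = 0 \<Longrightarrow> coeff (reps p {}) [] = 0"
  shows "p \<in> \<delta> i ` carrier (P (Suc i))"
proof -
  define r where "r k = (if k \<in> codes (Suc i) then proj (koszul_homotopy (reps p) (set_decode k)) else \<zero>\<^bsub>B\<^esub>)" for k
  have normal: "koszul_homotopy (reps p) T \<in> normal_polys n" for T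
    by (rule koszul_homotopy_normal[where p = "reps p", OF reps_normal[OF p]])
  have r: "r \<in> carrier (P (Suc i))"
    by (simp add: r_def proj_closed normal_polys_carrier normal)
  have reps_r: "reps r T = koszul_homotopy (reps p) T" if T: "T \<subseteq> {1..n}" for T
  proof (cases "card T = Suc i")
    case True
    then show ?thesis
      using T finite_subset[OF T] by (simp add: reps_def r_def encode_codes_iff rep_proj_normal normal)
  next
    case False
    \<comment> \<open>Removing the maximum from a set of the wrong size leaves a set of the wrong
      size, where \<open>reps p\<close> vanishes.\<close>
    have "koszul_homotopy (reps p) T = 0"
    proof (cases "T = {}")
      case nonempty: False
      have "finite T"
        using T by (rule finite_subset) simp
      then have "card (T - {Max T}) \<noteq> i"
        using False nonempty by (metis Max_in card.remove)
      then have "reps p (T - {Max T}) = 0"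
        using T by (intro reps_eq_0[OF p]) auto
      then show ?thesis
        by (simp add: koszul_homotopy_def)
    qed (simp add: koszul_homotopy_def)
    then show ?thesis
      using reps_eq_0[OF r T False] by simp
  qed
  have "\<delta> i r = p"
  proof (rule P_eqI[OF \<delta>_closed[OF r] p])
    fix T
    assume T: "T \<subseteq> {1..n}" "card T = i"
    have "reps (\<delta> i r) T = normal_form q (koszul_diff q n (koszul_homotopy (reps p)) T)"
      unfolding reps_\<delta>[OF r T(1)]
      using T by (intro arg_cong[where f = "normal_form q"] koszul_diff_cong reps_r) simp
    also have "\<dots> = reps p T"
    proof (cases "T = {}")
      case True
      then show ?thesis
        using koszul_homotopy_identity[where p = "reps p" and q = q, OF reps_normal[OF p] T(1)] aug T(2)
        by (simp add: koszul_homotopy_def)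
    next
      case False
      then show ?thesis
        using koszul_homotopy_identity[where p = "reps p" and q = q, OF reps_normal[OF p] T(1)] cycle[OF T(1)]
        by simp
    qed
    finally show "reps (\<delta> i r) T = reps p T" .
  qed
  with r show ?thesis
    by blast
qed

lemma exact_higher: "{p \<in> carrier (P (Suc i)). \<delta> i p = \<zero>\<^bsub>P i\<^esub>} = \<delta> (Suc i) ` carrier (P (Suc (Suc i)))"
proof (intro equalityI subsetI)
  fix p
  assume "p \<in> \<delta> (Suc i) ` carrier (P (Suc (Suc i)))"
  then obtain r where "r \<in> carrier (P (Suc (Suc i)))" "p = \<delta> (Suc i) r"
    by blast
  then show "p \<in> {p \<in> carrier (P (Suc i)). \<delta> i p = \<zero>\<^bsub>P i\<^esub>}"
    using \<delta>_closed \<delta>_\<delta> by blast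
next
  fix p
  assume "p \<in> {p \<in> carrier (P (Suc i)). \<delta> i p = \<zero>\<^bsub>P i\<^esub>}"
  then have p: "p \<in> carrier (P (Suc i))" and z: "\<delta> i p = \<zero>\<^bsub>P i\<^esub>"
    by blast+
  show "p \<in> \<delta> (Suc i) ` carrier (P (Suc (Suc i)))"
  proof (rule cycle_is_boundary[OF p])
    fix T
    assume T: "T \<subseteq> {1..n}" "T \<noteq> {}"
    have "normal_form q (koszul_diff q n (reps p) (T - {Max T})) = reps (\<delta> i p) (T - {Max T})"
      using T by (intro reps_\<delta>[OF p, symmetric]) blast
    also have "\<dots> = 0"
      by (simp add: z reps_def)
    finally show "koszul_homotopy (\<lambda>T. normal_form q (koszul_diff q n (reps p) T)) T = 0"
      by (simp add: koszul_homotopy_def)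
  qed simp
qed

section \<open>The augmentation ideal and exactness at the augmentation\<close>

abbreviation J where "J \<equiv> positive_part B GB"

text \<open>Expresses the augmentation ideal by the coefficient of the empty word, which is the
  defect in the homotopy identity.\<close>

lemma positive_part_eq: "J = {b \<in> carrier B. coeff (rep b) [] = 0}"
proof (intro equalityI subsetI)
  fix b
  assume "b \<in> J"
  then obtain D c where D: "finite D" "D \<subseteq> {1..}" "\<forall>d\<in>D. c d \<in> GB d" and b: "b = (\<Oplus>\<^bsub>B\<^esub>d\<in>D. c d)"
    by (auto simp: positive_part_def)
  then have c: "c \<in> D \<rightarrow> carrier B"
    by (simp add: GB_iff)
  have "rep b = (\<Sum>d\<in>D. rep (c d))"
    unfolding b by (rule additive_finsum[OF B.abelian_monoid_axioms _ _ c]) (simp_all add: rep_add)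
  moreover have "coeff (rep (c d)) [] = 0" if "d \<in> D" for d
    using that D by (force simp: GB_iff wpolys_iff)
  ultimately show "b \<in> {b \<in> carrier B. coeff (rep b) [] = 0}"
    using B.finsum_closed[OF c] by (simp add: b lookup_sum)
next
  fix b
  assume b: "b \<in> {b \<in> carrier B. coeff (rep b) [] = 0}"
  define D where "D = (\<lambda>w. int (length (letters w))) ` Poly_Mapping.keys (rep b)"
  define c where "c d = proj (degree_part d (rep b))" for d
  have c: "c d \<in> carrier B" "rep (c d) = degree_part d (rep b)" for d
    using b by (simp_all add: c_def rep_proj_normal proj_closed normal_polys_carrier degree_part_wpolys rep_normal)
  \<comment> \<open>Only the empty word has length 0, and it does not occur in
    \<open>rep b\<close>.\<close>
  have "D \<subseteq> {1..}"
  proof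
    fix d
    assume "d \<in> D"
    then obtain v where v: "v \<in> Poly_Mapping.keys (rep b)" "d = int (length (letters v))"
      by (auto simp: D_def)
    obtain w where "v = Word w"
      by (cases v)
    with v have w: "coeff (rep b) w \<noteq> 0" "d = int (length w)"
      by (simp_all add: in_keys_iff)
    with b show "d \<in> {1..}"
      by (cases w) auto
  qed
  moreover have "b = (\<Oplus>\<^bsub>B\<^esub>d\<in>D. c d)"
  proof -
    have "rep (\<Oplus>\<^bsub>B\<^esub>d\<in>D. c d) = (\<Sum>d\<in>D. degree_part d (rep b))"
      unfolding c(2)[symmetric] using c
      by (intro additive_finsum[OF B.abelian_monoid_axioms]) (simp_all add: rep_add)
    also have "\<dots> = rep b"
      using sum_degree_part[of D "rep b" 0] by (force simp: D_def in_keys_iff)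
    finally show ?thesis
      using b c B.finsum_closed[of c D] by (simp add: rep_inject)
  qed
  moreover have "c d \<in> GB d" for d
    by (simp add: GB_iff c degree_part_homogeneous)
  moreover have "finite D"
    by (simp add: D_def)
  ultimately show "b \<in> J"
    unfolding positive_part_def by blast
qed

lemma coeff_Nil_mult: "coeff (f * g) [] = coeff f [] * coeff g []" for f g :: "'k free_alg"
proof (rule additive_eqI[OF wpolys_True, of "\<lambda>f. coeff (f * g) []" "\<lambda>f. coeff f [] * coeff g []"], goal_cases)
  case (5 u c)
  show ?case
    by (rule additive_eqI[OF wpolys_True, of "\<lambda>g. coeff (term_of_word u c * g) []" "\<lambda>g. coeff (term_of_word u c) [] * coeff g []"])
      (auto simp: distrib_left lookup_add mult_single lookup_single when_def)
qed (simp_all add: distrib_right lookup_add)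

lemma coeff_Nil_normal_form: "coeff (normal_form q f) [] = coeff f []"
proof (rule additive_eqI[OF wpolys_True, of "\<lambda>f. coeff (normal_form q f) []"], goal_cases)
  case (5 w c)
  show ?case
    by (cases w) (auto simp: lookup_single when_def simp flip: length_0_conv)
qed (simp_all add: normal_form_add lookup_add)

lemma ideal_J: "ideal J B"
proof (rule idealI[OF ring_B])
  have "additive_subgroup J B"
  proof (rule additive_subgroupI_inverse[OF B.is_abelian_group])
    fix b
    assume b: "b \<in> J"
    then have "rep (\<ominus>\<^bsub>B\<^esub> b) + rep b = 0"
      by (simp add: positive_part_eq B.l_neg flip: rep_add)
    then have "coeff (rep (\<ominus>\<^bsub>B\<^esub> b)) [] + coeff (rep b) [] = 0"
      by (metis lookup_add lookup_zero)
    with b show "\<exists>c\<in>J. c \<oplus>\<^bsub>B\<^esub> b = \<zero>\<^bsub>B\<^esub>"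
      by (intro bexI[of _ "\<ominus>\<^bsub>B\<^esub> b"]) (simp_all add: positive_part_eq B.l_neg)
  qed (auto simp: positive_part_eq rep_add lookup_add)
  then show "subgroup J (add_monoid B)"
    by (rule additive_subgroup.a_subgroup)
qed (auto simp: positive_part_eq rep_mult coeff_Nil_normal_form coeff_Nil_mult)

sublocale J: ideal J B
  by (rule ideal_J)

text \<open>Coordinate \<open>0\<close> is the code of the empty set, the only basis index of
  \<open>P 0\<close>.\<close>

definition \<epsilon> :: "(nat \<Rightarrow> 'k free_alg set) \<Rightarrow> 'k free_alg set set" where
  "\<epsilon> p = J +>\<^bsub>B\<^esub> p 0"

lemma residue_module_simps:
  "carrier (residue_module B GB) = carrier (B Quot J)"
  "x \<oplus>\<^bsub>residue_module B GB\<^esub> y = x \<oplus>\<^bsub>B Quot J\<^esub> y"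
  "\<zero>\<^bsub>residue_module B GB\<^esub> = J"
  "b \<odot>\<^bsub>residue_module B GB\<^esub> x = (J +>\<^bsub>B\<^esub> b) \<otimes>\<^bsub>B Quot J\<^esub> x"
  by (simp_all add: residue_module_def Let_def FactRing_def)

lemma \<epsilon>_eq_zero_iff: "p \<in> carrier (P i) \<Longrightarrow> \<epsilon> p = J \<longleftrightarrow> p 0 \<in> J"
  unfolding \<epsilon>_def using J.a_rcos_self[of "p 0"] J.a_rcos_const by auto

lemma \<epsilon>_hom: "graded_hom B (P 0) (G 0) (residue_module B GB) (residue_grading B GB) \<epsilon>"
proof -
  note hom = J.rcos_ring_hom
  have "\<epsilon> p \<in> residue_grading B GB d" if p: "p \<in> G 0 d" for p d
  proof (cases "d = 0")
    case True
    then show ?thesis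
      using p ring_hom_closed[OF hom, of "p 0"]
      by (simp add: residue_grading_def residue_module_simps \<epsilon>_def free_grading_iff)
  next
    case False
    then have "coeff (rep (p 0)) [] = 0"
      using p by (force simp: free_grading_iff wpolys_iff)
    then have "p 0 \<in> J"
      unfolding positive_part_eq using p by (simp add: free_grading_iff)
    then have "\<epsilon> p = J"
      using p \<epsilon>_eq_zero_iff[of p 0] unfolding free_grading_iff by blast
    with False show ?thesis
      by (simp add: residue_grading_def residue_module_simps)
  qed
  then show ?thesis
    unfolding graded_hom_def residue_module_simps
    using ring_hom_closed[OF hom] ring_hom_add[OF hom] ring_hom_mult[OF hom]
    by (simp add: \<epsilon>_def image_subset_iff)
qed

lemma \<epsilon>_surj: "\<epsilon> ` carrier (P 0) = carrier (residue_module B GB)"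
proof (intro equalityI subsetI)
  fix z
  assume "z \<in> carrier (residue_module B GB)"
  then obtain b where b: "b \<in> carrier B" "z = J +>\<^bsub>B\<^esub> b"
    unfolding residue_module_simps FactRing_def A_RCOSETS_def' by auto
  then show "z \<in> \<epsilon> ` carrier (P 0)"
    by (intro image_eqI[of _ _ "\<lambda>k. if k = 0 then b else \<zero>\<^bsub>B\<^esub>"]) (simp_all add: \<epsilon>_def codes_0)
qed (use \<epsilon>_hom in \<open>auto simp: graded_hom_def\<close>)

lemma exact_zero: "{p \<in> carrier (P 0). \<epsilon> p = \<zero>\<^bsub>residue_module B GB\<^esub>} = \<delta> 0 ` carrier (P 1)"
proof (intro equalityI subsetI)
  fix p
  assume "p \<in> \<delta> 0 ` carrier (P 1)"
  then obtain r where r: "r \<in> carrier (P (Suc 0))" "p = \<delta> 0 r"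
    by (auto simp: One_nat_def)
  \<comment> \<open>Every term of the differential ends in a variable, so it has no constant
    term.\<close>
  have "coeff (koszul_diff q n (reps r) {}) [] = 0"
    by (simp add: koszul_diff_def lookup_sum coeff_Nil_mult lookup_single)
  then have "coeff (rep (p 0)) [] = 0"
    using rep_\<delta>[OF r(1), of 0] r by (simp add: codes_0 coeff_Nil_normal_form)
  moreover have p: "p \<in> carrier (P 0)"
    using r \<delta>_closed by blast
  ultimately have "p 0 \<in> J"
    unfolding positive_part_eq by simp
  with p show "p \<in> {p \<in> carrier (P 0). \<epsilon> p = \<zero>\<^bsub>residue_module B GB\<^esub>}"
    using \<epsilon>_eq_zero_iff[OF p] unfolding residue_module_simps by blast
next
  fix p
  assume "p \<in> {p \<in> carrier (P 0). \<epsilon> p = \<zero>\<^bsub>residue_module B GB\<^esub>}"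
  then have p: "p \<in> carrier (P 0)" and "\<epsilon> p = J"
    by (simp_all only: mem_Collect_eq residue_module_simps)
  then have "p 0 \<in> J"
    using \<epsilon>_eq_zero_iff[OF p] by blast
  then have aug: "coeff (reps p {}) [] = 0"
    unfolding positive_part_eq by (simp add: reps_def)
  have "p \<in> \<delta> 0 ` carrier (P (Suc 0))"
  proof (rule cycle_is_boundary[OF p])
    fix T
    assume "T \<subseteq> {1..n}" "T \<noteq> {}"
    \<comment> \<open>The differential reads only nonempty sets, while \<open>p\<close> lives on the
      empty set.\<close>
    have "koszul_diff q n (reps p) U = 0" if "U \<subseteq> {1..n}" for U
    proof -
      have "koszul_diff q n (reps p) U = koszul_diff q n (\<lambda>_. 0) U"
        using that finite_subset[OF that] by (intro koszul_diff_cong reps_eq_0[OF p]) auto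
      then show ?thesis
        by (simp add: koszul_diff_def)
    qed
    then show "koszul_homotopy (\<lambda>T. normal_form q (koszul_diff q n (reps p) T)) T = 0"
      using \<open>T \<subseteq> {1..n}\<close> by (simp add: koszul_homotopy_def subset_iff)
  qed (rule aug)
  then show "p \<in> \<delta> 0 ` carrier (P 1)"
    by (simp add: One_nat_def)
qed

theorem linear_free_resolution: "has_linear_free_resolution B GB"
  unfolding has_linear_free_resolution_def
proof (intro exI conjI allI)
  show "graded_free_in_degree B GB (P i) (G i) (int i)" for i
    by (rule free_module_graded_free[OF finite_codes])
qed (rule \<delta>_hom \<epsilon>_hom \<epsilon>_surj exact_zero exact_higher)+

end

section \<open>Sorted words and standard monomials\<close>

text \<open>Sorted words over \<open>{1..n}\<close> correspond to exponents; counting letters is the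
  inverse.\<close>

definition sorted_word :: "nat \<Rightarrow> (nat \<Rightarrow> nat) \<Rightarrow> nat list" where
  "sorted_word n \<alpha> = concat (map (\<lambda>i. replicate (\<alpha> i) i) [1..<Suc n])"

lemma sorted_word_Suc: "sorted_word (Suc n) \<alpha> = sorted_word n \<alpha> @ replicate (\<alpha> (Suc n)) (Suc n)"
  by (simp add: sorted_word_def)

lemma set_sorted_word: "set (sorted_word n \<alpha>) \<subseteq> {1..n}"
  by (auto simp: sorted_word_def)

lemma sorted_sorted_word: "sorted (sorted_word n \<alpha>)"
proof (induction n)
  case (Suc n)
  have "a \<le> Suc n" if "a \<in> set (sorted_word n \<alpha>)" for a
    using that set_sorted_word[of n \<alpha>] by fastforce
  with Suc show ?case
    by (simp add: sorted_word_Suc sorted_append sorted_replicate)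
qed (simp add: sorted_word_def)

lemma count_sorted_word: "count (mset (sorted_word n \<alpha>)) j = (if j \<in> {1..n} then \<alpha> j else 0)"
  by (induction n) (auto simp: sorted_word_Suc le_Suc_eq, simp add: sorted_word_def)

lemma sorted_word_count:
  assumes "sorted w" "set w \<subseteq> {1..n}"
  shows "sorted_word n (count (mset w)) = w"
proof -
  have "mset (sorted_word n (count (mset w))) = mset w"
  proof (rule multiset_eqI)
    fix j
    show "count (mset (sorted_word n (count (mset w)))) j = count (mset w) j"
      using assms(2) by (auto simp: count_sorted_word subset_iff count_eq_zero_iff)
  qed
  then show ?thesis
    using properties_for_sort[OF _ sorted_sorted_word] assms(1) by (metis sorted_sort_id)
qed

lemma prod_list_sorted_word: "prod_list (map x (sorted_word n \<alpha>)) = standard_monomial x n \<alpha>"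
proof -
  have "prod_list (map x (concat (map (\<lambda>i. replicate (\<alpha> i) i) js))) = prod_list (map (\<lambda>i. x i ^ \<alpha> i) js)" for js
    by (induction js) (simp_all add: map_replicate prod_list_replicate)
  then show ?thesis
    by (simp add: sorted_word_def standard_monomial_def)
qed

lemma count_exponents: "set w \<subseteq> {1..n} \<Longrightarrow> count (mset w) \<in> exponents n"
  by (auto simp: exponents_def count_eq_zero_iff)

section \<open>Linear and quadratic word polynomials\<close>

lemma coeff_double_sum:
  "coeff (\<Sum>j\<in>{1..n}. \<Sum>k\<in>{1..n}. term_of_word [j, k] (r j k)) w =
    (if length w = 2 \<and> set w \<subseteq> {1..n} then r (w ! 0) (w ! 1) else 0)"
proof (cases "length w = 2")
  case True
  then obtain a b where w: "w = [a, b]"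
    by (auto simp: numeral_2_eq_2 length_Suc_conv)
  have "coeff (\<Sum>j\<in>{1..n}. \<Sum>k\<in>{1..n}. term_of_word [j, k] (r j k)) w
      = (\<Sum>j\<in>{1..n}. if j = a then (\<Sum>k\<in>{1..n}. if k = b then r a b else 0) else 0)"
    unfolding lookup_sum w by (rule sum.cong) (auto simp: lookup_single when_def intro!: sum.neutral sum.cong)
  then show ?thesis
    by (simp add: w)
next
  case False
  then show ?thesis
    by (auto simp: lookup_sum lookup_single when_def intro!: sum.neutral)
qed

lemma coeff_single_sum:
  "coeff (\<Sum>k\<in>{1..n}. term_of_word [k] (r k)) w = (if length w = 1 \<and> set w \<subseteq> {1..n} then r (w ! 0) else 0)"
proof (cases "length w = 1")
  case True
  then obtain a where w: "w = [a]"
    by (auto simp: One_nat_def length_Suc_conv)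
  have "coeff (\<Sum>k\<in>{1..n}. term_of_word [k] (r k)) w = (\<Sum>k\<in>{1..n}. if k = a then r a else 0)"
    unfolding lookup_sum w by (rule sum.cong) (auto simp: lookup_single when_def)
  then show ?thesis
    by (simp add: w)
next
  case False
  then show ?thesis
    by (auto simp: lookup_sum lookup_single when_def intro!: sum.neutral)
qed

lemma linear_quadraticI:
  assumes "f \<in> wpolys (\<lambda>w. (length w = 1 \<or> length w = 2) \<and> set w \<subseteq> {1..n})"
  shows "f \<in> linear_quadratic n"
proof -
  have "f = (\<Sum>i\<in>{1..n}. term_of_word [i] (coeff f [i])) +
      (\<Sum>j\<in>{1..n}. \<Sum>k\<in>{1..n}. term_of_word [j, k] (coeff f [j, k]))"
  proof (rule coeff_eqI)
    fix w :: "nat list"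
    have "w = [w ! 0]" if "length w = 1"
      using that by (auto simp: One_nat_def length_Suc_conv)
    moreover have "w = [w ! 0, w ! 1]" if "length w = 2"
      using that by (auto simp: numeral_2_eq_2 length_Suc_conv)
    ultimately show "coeff f w = coeff ((\<Sum>i\<in>{1..n}. term_of_word [i] (coeff f [i])) +
        (\<Sum>j\<in>{1..n}. \<Sum>k\<in>{1..n}. term_of_word [j, k] (coeff f [j, k]))) w"
      using assms unfolding lookup_add coeff_double_sum coeff_single_sum wpolys_iff
      by (cases "coeff f w = 0") auto
  qed
  then show ?thesis
    unfolding linear_quadratic_def by (intro CollectI exI conjI TrueI)
qed

lemma homogeneous_quadraticI:
  assumes "f \<in> wpolys (\<lambda>w. length w = 2 \<and> set w \<subseteq> {1..n})"
  shows "f \<in> homogeneous_quadratic n"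
proof -
  have "f = (\<Sum>j\<in>{1..n}. \<Sum>k\<in>{1..n}. term_of_word [j, k] (coeff f [j, k]))"
  proof (rule coeff_eqI)
    fix w :: "nat list"
    have "w = [w ! 0, w ! 1]" if "length w = 2"
      using that by (auto simp: numeral_2_eq_2 length_Suc_conv)
    then show "coeff f w = coeff (\<Sum>j\<in>{1..n}. \<Sum>k\<in>{1..n}. term_of_word [j, k] (coeff f [j, k])) w"
      using assms unfolding coeff_double_sum wpolys_iff by (cases "coeff f w = 0") auto
  qed
  then show ?thesis
    unfolding homogeneous_quadratic_def by (intro CollectI exI conjI TrueI)
qed

lemma quadratic_part_eq: "quadratic_part f = degree_part 2 f"
proof -
  have "quadratic_part f = (\<Sum>w\<in>Poly_Mapping.keys f.
      if length (letters w) = 2 then Poly_Mapping.single w (Poly_Mapping.lookup f w) else 0)"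
    unfolding quadratic_part_def by (rule sum.inter_filter) simp
  then show ?thesis
    by (simp add: degree_part_def word_lin_def cong: if_cong)
qed

text \<open>Comparing coefficients covers \<open>i = j\<close> as well, where the two quadratic
  terms merge and may cancel.\<close>

lemma quadratic_part_relation:
  "quadratic_part (term_of_word [j, i] 1 - term_of_word [i, j] c + (\<Sum>k\<in>{1..n}. term_of_word [k] (r k)))
    = term_of_word [j, i] 1 - term_of_word [i, j] c"
  unfolding quadratic_part_eq
proof (rule coeff_eqI)
  fix w
  show "coeff (degree_part 2 (term_of_word [j, i] 1 - term_of_word [i, j] c + (\<Sum>k\<in>{1..n}. term_of_word [k] (r k)))) w
      = coeff (term_of_word [j, i] 1 - term_of_word [i, j] c) w"
    unfolding coeff_degree_part lookup_add lookup_minus coeff_single_sum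
    by (auto simp: lookup_single when_def)
qed

section \<open>Evaluation in a skew PBW extension\<close>

locale constant_pbw_extension =
  fixes \<iota> :: "'k::field \<Rightarrow> 'a::ring_1" and x :: "nat \<Rightarrow> 'a" and n :: nat
  assumes pbw: "skew_PBW_extension \<iota> x n" and central: "constant_extension \<iota>"
begin

lemma \<iota>_one [simp]: "\<iota> 1 = 1" and \<iota>_add [simp]: "\<iota> (r + s) = \<iota> r + \<iota> s"
  and \<iota>_mult: "\<iota> (r * s) = \<iota> r * \<iota> s"
  using pbw by (auto simp: skew_PBW_extension_def field_embedding_def)

lemma \<iota>_zero [simp]: "\<iota> 0 = 0"
  using \<iota>_add[of 0 0] by simp

lemma \<iota>_uminus [simp]: "\<iota> (- r) = - \<iota> r"
  using \<iota>_add[of r "- r"] by (simp add: eq_neg_iff_add_eq_0 add.commute)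

lemma \<iota>_central: "a * \<iota> r = \<iota> r * a"
  using central unfolding constant_extension_def by metis

lemma \<iota>_left_commute: "a * (\<iota> r * b) = \<iota> r * (a * b)"
  by (metis \<iota>_central mult.assoc)

sublocale V: Modules.module "\<lambda>r a. \<iota> r * a"
  by standard (simp_all add: distrib_left distrib_right \<iota>_mult mult.assoc)

abbreviation "ev \<equiv> eval_free \<iota> x"

lemma eval_word_lin: "ev = word_lin (\<lambda>w c. \<iota> c * prod_list (map x w))"
  by (simp add: fun_eq_iff eval_free_def word_lin_def)

lemma eval_zero [simp]: "ev 0 = 0"
  by (simp add: eval_word_lin)

lemma eval_term [simp]: "ev (term_of_word w c) = \<iota> c * prod_list (map x w)"
  by (simp add: eval_word_lin)

lemma eval_add: "ev (f + g) = ev f + ev g"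
  unfolding eval_word_lin by (rule word_lin_add) (simp_all add: distrib_right)

lemma eval_uminus: "ev (- f) = - ev f"
  using eval_add[of f "- f"] by (simp add: eq_neg_iff_add_eq_0 add.commute)

lemma eval_diff: "ev (f - g) = ev f - ev g"
  using eval_add[of f "- g"] by (simp add: eval_uminus)

lemma eval_sum: "ev (sum f A) = (\<Sum>a\<in>A. ev (f a))"
  by (induction A rule: infinite_finite_induct) (simp_all add: eval_add)

lemma eval_mult: "ev (f * g) = ev f * ev g"
proof -
  have words: "ev (term_of_word u c * term_of_word v d) = ev (term_of_word u c) * ev (term_of_word v d)" for u v c d
  proof -
    have "prod_list (map x u) * (\<iota> d * prod_list (map x v)) = \<iota> d * (prod_list (map x u) * prod_list (map x v))"
      by (rule \<iota>_left_commute)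
    then show ?thesis
      by (simp add: mult_single mult.assoc \<iota>_mult del: V.scale_scale)
  qed
  have left_word: "ev (term_of_word u c * g) = ev (term_of_word u c) * ev g" for u c
    by (rule additive_eqI[OF wpolys_True, of "\<lambda>g. ev (term_of_word u c * g)" "\<lambda>g. ev (term_of_word u c) * ev g"])
      (simp_all only: words distrib_left eval_add mult_zero_right eval_zero)
  show ?thesis
    by (rule additive_eqI[OF wpolys_True, of "\<lambda>f. ev (f * g)" "\<lambda>f. ev f * ev g"])
      (simp_all only: left_word distrib_right eval_add mult_zero_left eval_zero)
qed

text \<open>Sorted words evaluate to standard monomials, so this is their linear independence in
  polynomial form. It supplies the uniqueness that rewriting alone does not give.\<close>

lemma eval_eq_0_imp_eq_0:
  assumes g: "g \<in> normal_polys n" and eval: "ev g = 0"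
  shows "g = 0"
proof -
  define mon where "mon w = prod_list (map x (letters w))" for w
  have keys: "sorted (letters w) \<and> set (letters w) \<subseteq> {1..n}" if "w \<in> Poly_Mapping.keys g" for w
    using g that by (simp add: wpolys_def)
  have mon: "mon w = standard_monomial x n (count (mset (letters w)))" if "w \<in> Poly_Mapping.keys g" for w
    using keys[OF that] by (simp add: mon_def sorted_word_count flip: prod_list_sorted_word)
  \<comment> \<open>Independence is a statement about sets of vectors; injectivity keeps distinct
    words from merging their coefficients.\<close>
  have inj: "inj_on mon (Poly_Mapping.keys g)"
  proof (rule inj_onI)
    fix v w
    assume v: "v \<in> Poly_Mapping.keys g" and w: "w \<in> Poly_Mapping.keys g" and "mon v = mon w"
    moreover have "inj_on (standard_monomial x n) (exponents n)"
      using pbw by (simp add: skew_PBW_extension_def)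
    ultimately have "count (mset (letters v)) = count (mset (letters w))"
      using keys by (simp add: mon inj_on_def count_exponents)
    then show "v = w"
      using keys[OF v] keys[OF w] by (metis free_monoid.expand sorted_word_count)
  qed
  have indep: "V.independent (standard_monomial x n ` exponents n)"
    using pbw by (simp add: skew_PBW_extension_def)
  define u where "u = (\<lambda>v. Poly_Mapping.lookup g (the_inv_into (Poly_Mapping.keys g) mon v))"
  have u: "u (mon w) = Poly_Mapping.lookup g w" if "w \<in> Poly_Mapping.keys g" for w
    using that inj by (simp add: u_def the_inv_into_f_f)
  have "(\<Sum>v\<in>mon ` Poly_Mapping.keys g. \<iota> (u v) * v) = ev g"
    by (simp add: sum.reindex[OF inj] eval_free_def u flip: mon_def)
  then have sum0: "(\<Sum>v\<in>mon ` Poly_Mapping.keys g. \<iota> (u v) * v) = 0"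
    using eval by simp
  have sub: "mon ` Poly_Mapping.keys g \<subseteq> standard_monomial x n ` exponents n"
    using keys by (auto simp: mon count_exponents)
  have "w \<notin> Poly_Mapping.keys g" for w
  proof
    assume w: "w \<in> Poly_Mapping.keys g"
    then have "u (mon w) = 0"
      using V.independentD[OF indep _ sub sum0] by simp
    with w show False
      by (simp add: u in_keys_iff)
  qed
  then show ?thesis
    by (intro poly_mapping_eqI) (simp add: in_keys_iff)
qed

lemma eval_surj: "ev ` carrier (free_algebra n) = UNIV"
proof -
  have "V.subspace (ev ` carrier (free_algebra n))"
  proof (rule V.subspaceI)
    have "ev 0 \<in> ev ` carrier (free_algebra n)"
      by (rule imageI) (simp add: carrier_free_algebra)
    then show "0 \<in> ev ` carrier (free_algebra n)"
      by simp
  next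
    fix a b
    assume "a \<in> ev ` carrier (free_algebra n)" "b \<in> ev ` carrier (free_algebra n)"
    then obtain f g where "f \<in> carrier (free_algebra n)" "g \<in> carrier (free_algebra n)" "a = ev f" "b = ev g"
      by blast
    then show "a + b \<in> ev ` carrier (free_algebra n)"
      by (intro image_eqI[of _ _ "f + g"]) (simp_all add: eval_add carrier_free_algebra wpolys_add)
  next
    fix c :: 'k and a
    assume "a \<in> ev ` carrier (free_algebra n)"
    then obtain f where "f \<in> carrier (free_algebra n)" "a = ev f"
      by blast
    moreover have "const c \<in> wpolys (\<lambda>w. set w \<subseteq> {1..n})"
      unfolding zero_eq_Word by (rule wpolys_term) simp
    moreover have "ev (const c) = \<iota> c"
      by (simp add: zero_eq_Word)
    ultimately show "\<iota> c * a \<in> ev ` carrier (free_algebra n)"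
      by (intro image_eqI[of _ _ "const c * f"]) (simp_all add: eval_mult carrier_free_algebra wpolys_letters_mult)
  qed
  moreover have "standard_monomial x n ` exponents n \<subseteq> ev ` carrier (free_algebra n)"
  proof
    fix a
    assume "a \<in> standard_monomial x n ` exponents n"
    then obtain \<alpha> where "a = standard_monomial x n \<alpha>"
      by blast
    then show "a \<in> ev ` carrier (free_algebra n)"
      using set_sorted_word[of n \<alpha>]
      by (intro image_eqI[of _ _ "term_of_word (sorted_word n \<alpha>) 1"])
        (simp_all add: prod_list_sorted_word carrier_free_algebra wpolys_term)
  qed
  ultimately have "V.span (standard_monomial x n ` exponents n) \<subseteq> ev ` carrier (free_algebra n)"
    by (rule V.span_minimal[rotated])
  then show ?thesis
    using pbw by (auto simp: skew_PBW_extension_def)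
qed

lemma eval_kernel_ideal: "ideal {f \<in> carrier (free_algebra n). ev f = 0} (free_algebra n)"
  unfolding ideal_free_algebra_iff carrier_free_algebra
  by (auto simp: eval_add eval_uminus eval_mult wpolys_add wpolys_uminus wpolys_letters_mult)

text \<open>The word \<open>[a, b]\<close> is sorted, so its coefficient can be compared with
  \<open>0\<close>. This pins down the coefficients of the relations.\<close>

lemma quadratic_independent:
  assumes eq: "\<iota> d * (x a * x b) + (\<Sum>k\<in>{1..n}. \<iota> (r k) * x k) = 0"
    and ab: "a \<in> {1..n}" "b \<in> {1..n}" "a \<le> b"
  shows "d = 0"
proof -
  let ?g = "term_of_word [a, b] d + (\<Sum>k\<in>{1..n}. term_of_word [k] (r k))"
  have "?g \<in> normal_polys n"
    using ab by (intro wpolys_add wpolys_sum wpolys_term) auto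
  moreover have "ev ?g = 0"
    using eq by (simp add: eval_add eval_sum)
  ultimately have "?g = 0"
    by (rule eval_eq_0_imp_eq_0)
  then have "coeff ?g [a, b] = 0"
    by (simp only: lookup_zero)
  then show ?thesis
    by (simp add: lookup_add coeff_single_sum)
qed

end

text \<open>Fixes one choice of coefficients and linear parts for each ordered pair of variables,
  whereas \<open>R\<close> contains every valid relation of the prescribed shape.\<close>

locale pre_commutative_pbw_extension = constant_pbw_extension \<iota> x n
  for \<iota> :: "'k::field \<Rightarrow> 'a::ring_1" and x :: "nat \<Rightarrow> 'a" and n :: nat +
  fixes q :: "nat \<Rightarrow> nat \<Rightarrow> 'k" and l :: "nat \<Rightarrow> nat \<Rightarrow> nat \<Rightarrow> 'k"
  assumes q_nonzero: "a \<in> {1..n} \<Longrightarrow> b \<in> {1..n} \<Longrightarrow> q a b \<noteq> 0"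
    and commutation: "a \<in> {1..n} \<Longrightarrow> b \<in> {1..n} \<Longrightarrow>
      x a * x b - \<iota> (q a b) * x b * x a = (\<Sum>k\<in>{1..n}. \<iota> (l a b k) * x k)"
begin

abbreviation "R \<equiv> defining_relations \<iota> x n"

lemma relation_mem:
  assumes "a \<in> {1..n}" "b \<in> {1..n}"
  shows "term_of_word [a, b] 1 - term_of_word [b, a] (q a b) + (\<Sum>k\<in>{1..n}. term_of_word [k] (- l a b k)) \<in> R"
proof -
  have "ev (term_of_word [a, b] 1 - term_of_word [b, a] (q a b) + (\<Sum>k\<in>{1..n}. term_of_word [k] (- l a b k))) = 0"
    using commutation[OF assms]
    by (simp add: eval_add eval_diff eval_sum mult.assoc sum_negf single_uminus eval_uminus)
  then show ?thesis
    unfolding defining_relations_def using assms q_nonzero[OF assms]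
    by (intro CollectI conjI bexI[of _ b] bexI[of _ a] exI[of _ "q a b"] exI[of _ "\<lambda>k. - l a b k"] refl)
qed

lemma relations_wpolys: "R \<subseteq> wpolys (\<lambda>w. (length w = 1 \<or> length w = 2) \<and> set w \<subseteq> {1..n})"
  unfolding defining_relations_def
  by (auto intro!: wpolys_add wpolys_diff wpolys_sum wpolys_term)

lemma relations_carrier: "R \<subseteq> carrier (free_algebra n)"
  unfolding carrier_free_algebra using relations_wpolys by (blast intro: wpolys_mono)

text \<open>Rewriting by the chosen relations turns an element of the kernel into a sorted
  polynomial of value \<open>0\<close>, which is \<open>0\<close> by the PBW property.\<close>

lemma kernel_eq_ideal: "{f \<in> carrier (free_algebra n). ev f = 0} = Idl\<^bsub>free_algebra n\<^esub> R"
proof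
  have "R \<subseteq> {f \<in> carrier (free_algebra n). ev f = 0}"
    using relations_carrier unfolding defining_relations_def by blast
  then show sub: "Idl\<^bsub>free_algebra n\<^esub> R \<subseteq> {f \<in> carrier (free_algebra n). ev f = 0}"
    by (rule ring.genideal_minimal[OF free_algebra_ring eval_kernel_ideal])
  show "{f \<in> carrier (free_algebra n). ev f = 0} \<subseteq> Idl\<^bsub>free_algebra n\<^esub> R"
  proof
    fix f
    assume f: "f \<in> {f \<in> carrier (free_algebra n). ev f = 0}"
    have "\<exists>g\<in>normal_polys n. f - g \<in> Idl\<^bsub>free_algebra n\<^esub> R"
    proof (rule congruent_to_sorted[where q = q])
      show "ideal (Idl\<^bsub>free_algebra n\<^esub> R) (free_algebra n)"
        by (rule ring.genideal_ideal[OF free_algebra_ring relations_carrier])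
      fix a b
      assume "a \<in> {1..n}" "b \<in> {1..n}"
      then show "\<exists>r. term_of_word [a, b] 1 - term_of_word [b, a] (q a b)
          + (\<Sum>k\<in>{1..n}. term_of_word [k] (r k)) \<in> Idl\<^bsub>free_algebra n\<^esub> R"
        using relation_mem ring.genideal_self[OF free_algebra_ring relations_carrier]
        by (intro exI[of _ "\<lambda>k. - l a b k"]) blast
    qed (use f in simp)
    then obtain g where g: "g \<in> normal_polys n" "f - g \<in> Idl\<^bsub>free_algebra n\<^esub> R"
      by blast
    then have "ev (f - g) = 0"
      using sub by blast
    then have "g = 0"
      using f g(1) eval_eq_0_imp_eq_0 by (simp add: eval_diff)
    with g(2) show "f \<in> Idl\<^bsub>free_algebra n\<^esub> R"
      by simp
  qed
qed

text \<open>A relation in \<open>R\<close> need not be a chosen one, but comparison with the chosen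
  one forces its coefficient: \<open>c\<close> is \<open>q j i\<close> for \<open>i < j\<close>,
  \<open>1\<close> for \<open>i = j\<close>, and inverse to \<open>q i j\<close> for
  \<open>j < i\<close>. Any other value would give a truncated relation that kills a sorted
  word.\<close>

lemma quadratic_relation_normal_form:
  assumes "f \<in> quadratic_part ` R"
  shows "normal_form q f = 0"
proof -
  obtain i j c r where ij: "i \<in> {1..n}" "j \<in> {1..n}"
    and f: "f = term_of_word [j, i] 1 - term_of_word [i, j] c"
    and eval: "ev (term_of_word [j, i] 1 - term_of_word [i, j] c + (\<Sum>k\<in>{1..n}. term_of_word [k] (r k))) = 0"
    using assms by (auto simp: defining_relations_def quadratic_part_relation)
  have rel: "x j * x i = \<iota> c * (x i * x j) - (\<Sum>k\<in>{1..n}. \<iota> (r k) * x k)"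
    using eval by (simp add: eval_add eval_diff eval_sum algebra_simps)
  consider "i < j" | "i = j" | "j < i"
    by linarith
  then show ?thesis
  proof cases
    case 1
    \<comment> \<open>Both relations expand \<open>x j * x i\<close>; their difference involves only
      sorted monomials.\<close>
    have "\<iota> (c - q j i) * (x i * x j) + (\<Sum>k\<in>{1..n}. \<iota> (- r k - l j i k) * x k)
        = \<iota> c * (x i * x j) - (\<Sum>k\<in>{1..n}. \<iota> (r k) * x k) - (\<iota> (q j i) * x i * x j + (\<Sum>k\<in>{1..n}. \<iota> (l j i k) * x k))"
      by (simp add: V.scale_left_diff_distrib sum_subtractf sum_negf mult.assoc)
    also have "\<dots> = 0"
      using commutation[OF ij(2,1)] rel by (simp add: diff_eq_eq)
    finally have "c - q j i = 0"
      by (rule quadratic_independent) (use 1 ij in simp_all)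
    then show ?thesis
      using 1 by (simp add: f normal_form_diff swap_weight_def)
  next
    case 2
    have "\<iota> (c - 1) * (x i * x j) + (\<Sum>k\<in>{1..n}. \<iota> (- r k) * x k) = 0"
      using rel 2 by (simp add: V.scale_left_diff_distrib sum_negf algebra_simps)
    then have "c - 1 = 0"
      by (rule quadratic_independent) (use 2 ij in simp_all)
    then show ?thesis
      using 2 by (simp add: f)
  next
    case 3
    \<comment> \<open>Here \<open>x i * x j\<close> is the unsorted product; inserting its chosen
      expansion leaves \<open>x j * x i\<close> as the only quadratic monomial.\<close>
    have "\<iota> (c * q i j - 1) * (x j * x i) + (\<Sum>k\<in>{1..n}. \<iota> (c * l i j k - r k) * x k)
        = \<iota> c * (\<iota> (q i j) * x j * x i + (\<Sum>k\<in>{1..n}. \<iota> (l i j k) * x k)) - (\<Sum>k\<in>{1..n}. \<iota> (r k) * x k) - x j * x i"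
      by (simp add: V.scale_left_diff_distrib sum_subtractf sum_distrib_left distrib_left mult.assoc)
    also have "\<dots> = 0"
      using commutation[OF ij] rel by (simp add: diff_eq_eq add.commute)
    finally have "c * q i j - 1 = 0"
      by (rule quadratic_independent) (use 3 ij in simp_all)
    then show ?thesis
      using 3 by (simp add: f normal_form_diff swap_weight_def mult.commute)
  qed
qed

lemma quadratic_relations_wpolys: "quadratic_part ` R \<subseteq> wpolys (\<lambda>w. length w = 2 \<and> set w \<subseteq> {1..n})"
  by (auto simp: defining_relations_def quadratic_part_relation intro!: wpolys_diff wpolys_term)

lemma quantum_affine_space: "quantum_affine_space n q (quadratic_part ` R)"
proof
  show carrier: "quadratic_part ` R \<subseteq> carrier (free_algebra n)"
    unfolding carrier_free_algebra using quadratic_relations_wpolys by (blast intro: wpolys_mono)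
  show "Idl\<^bsub>free_algebra n\<^esub> (quadratic_part ` R) = {f \<in> carrier (free_algebra n). normal_form q f = 0}"
  proof (rule quantum_relations_generate_kernel[OF carrier quadratic_relation_normal_form])
    fix a b
    assume ab: "a \<in> {1..n}" "b \<in> {1..n}"
    show "term_of_word [a, b] 1 - term_of_word [b, a] (q a b) \<in> quadratic_part ` R"
      using imageI[OF relation_mem[OF ab], of quadratic_part] unfolding quadratic_part_relation .
  qed
qed

lemma koszul: "koszul \<iota> x n R"
  unfolding koszul_def pre_koszul_def homogeneous_koszul_def
proof (intro conjI)
  show "R \<subseteq> linear_quadratic n"
    using relations_wpolys linear_quadraticI by blast
  show "quadratic_part ` R \<subseteq> homogeneous_quadratic n"
    using quadratic_relations_wpolys homogeneous_quadraticI by blast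
qed (rule eval_surj kernel_eq_ideal quantum_affine_space.linear_free_resolution[OF quantum_affine_space])+

end

theorem theorem3p14:
  fixes \<iota> :: "'k::field \<Rightarrow> 'a::ring_1" and x :: "nat \<Rightarrow> 'a" and n :: nat
  assumes "skew_PBW_extension \<iota> x n"
    and "constant_extension \<iota>"
    and "pre_commutative \<iota> x n"
  shows "koszul \<iota> x n (defining_relations \<iota> x n)"
proof -
  \<comment> \<open>Moving the membership conditions inside the existential lets the choice yield
    total functions \<open>q\<close> and \<open>l\<close>.\<close>
  have "\<forall>a b. \<exists>c r. a \<in> {1..n} \<longrightarrow> b \<in> {1..n} \<longrightarrow> c \<noteq> 0 \<and>
      x a * x b - \<iota> c * x b * x a = (\<Sum>k\<in>{1..n}. \<iota> (r k) * x k)"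
    using assms(3) unfolding pre_commutative_def by blast
  then obtain q l where "\<And>a b. a \<in> {1..n} \<Longrightarrow> b \<in> {1..n} \<Longrightarrow> q a b \<noteq> 0 \<and>
      x a * x b - \<iota> (q a b) * x b * x a = (\<Sum>k\<in>{1..n}. \<iota> (l a b k) * x k)"
    by metis
  with assms(1,2) interpret pre_commutative_pbw_extension \<iota> x n q l
    by unfold_locales blast+
  show ?thesis
    by (rule koszul)
qed

end
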